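(* Let $\lambda>0$, $\nu\in(0,1]$, $\delta>0$, and let $N^{\nu,\delta}(t)$, $t\ge 0$, be the renewal process whose i.i.d. waiting times have probability density $$f^{\nu,\delta}(t)=\lambda^\delta t^{\delta\nu-1}E_{\nu,\delta\nu}^{\delta}(-\lambda t^\nu),\qquad t>0.$$ Then, for any $\theta\in\mathbb C$ with $\Re(\theta)>0$, the state probabilities $p_k^{\nu,\delta}(t)=\Pr\{N^{\nu,\delta}(t)=k\}$, $k\ge 0$, satisfy, for $t>0$, $$\frac{\mathrm d^{\nu\delta+\theta}}{\mathrm dt^{\nu\delta+\theta}}\left(\mathbf E_{\nu,\theta,-\lambda;0+}^{-\delta}\,p_k^{\nu,\delta}\right)(t)=\lambda^\delta p_{k-1}^{\nu,\delta}(t)+\delta_{k,0}\left(t^{-\nu\delta}E_{\nu,1-\nu\delta}^{-\delta}(-\lambda t^\nu)-\lambda^\delta\right),$$ where $p_{-1}^{\nu,\delta}\equiv 0$, $\delta_{k,0}$ is the Kronecker delta, $\mathbf E_{\nu,\theta,-\lambda;0+}^{-\delta}$ is the Prabhakar operator, and $\frac{\mathrm d^{\nu\delta+\theta}}{\mathrm dt^{\nu\delta+\theta}}$ is the Riemann--Liouville fractional derivative of order $\nu\delta+\theta$.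
   Context: The generalized (three-parameter) Mittag--Leffler function is $$E_{\beta,\gamma}^{\xi}(z)=\sum_{r=0}^\infty\frac{(\xi)_r}{r!\,\Gamma(\beta r+\gamma)}z^r,\qquad \beta,\gamma,\xi,z\in\mathbb C,\ \Re(\beta)>0,$$ where $(\xi)_0=1$ and $(\xi)_r=\xi(\xi+1)\cdots(\xi+r-1)$ for $r\ge 1$ is the Pochhammer symbol, and $1/\Gamma$ is taken to be $0$ at the poles of $\Gamma$. The function $f^{\nu,\delta}$ is the generalized Mittag--Leffler density; its Laplace transform is $\lambda^\delta/(s^\nu+\lambda)^\delta$. Let $\mathcal T_1,\mathcal T_2,\dots$ be i.i.d. random variables with density $f^{\nu,\delta}$, and put $T_0^{\nu,\delta}=0$, $T_m^{\nu,\delta}=\mathcal T_1+\dots+\mathcal T_m$. The renewal process is $N^{\nu,\delta}(t)=\max\{m\ge 0: T_m^{\nu,\delta}\le t\}$, $t\ge 0$. The Prabhakar operator is $$\left(\mathbf E_{\rho,\mu,\omega;a+}^{\gamma}\phi\right)(x)=\int_a^x(x-y)^{\mu-1}E_{\rho,\mu}^{\gamma}\left(\omega(x-y)^\rho\right)\phi(y)\,\mathrm dy,\qquad x>a,$$ with $\rho,\mu,\gamma\in\mathbb C$, $\Re(\rho)>0$, $\Re(\mu)>0$. The Riemann--Liouville fractional integral of order $\beta$, $\Re(\beta)>0$, is $(J_{t,0+}^{\beta}g)(t)=\frac1{\Gamma(\beta)}\int_0^t(t-y)^{\beta-1}g(y)\,\mathrm dy$, and the Riemann--Liouville fractional derivative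 of order $\alpha$, $\Re(\alpha)>0$, is $\frac{\mathrm d^\alpha}{\mathrm dt^\alpha}g(t)=\frac{\mathrm d^n}{\mathrm dt^n}\left(J_{t,0+}^{n-\alpha}g\right)(t)$, where $n$ is the integer with $n-1\le\Re(\alpha)<n$. *)

theory Defs
  imports "HOL-Probability.Probability"
begin

text \<open>\<open>rGamma\<close> is the entire function 1/Gamma, which vanishes at the poles of Gamma.\<close>

definition mittag_leffler3 :: "complex \<Rightarrow> complex \<Rightarrow> complex \<Rightarrow> complex \<Rightarrow> complex" where
  "mittag_leffler3 \<beta> \<gamma> \<xi> z =
     (\<Sum>r. pochhammer \<xi> r / fact r * rGamma (\<beta> * of_nat r + \<gamma>) * z ^ r)"

text \<open>For real parameters the Mittag-Leffler value below is real, so \<open>Re\<close> only changes the type.\<close>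

definition ml_density :: "real \<Rightarrow> real \<Rightarrow> real \<Rightarrow> real \<Rightarrow> real" where
  "ml_density lam \<nu> \<delta> t =
     (if t > 0
      then lam powr \<delta> * t powr (\<delta> * \<nu> - 1) *
           Re (mittag_leffler3 (of_real \<nu>) (of_real (\<delta> * \<nu>)) (of_real \<delta>)
                 (of_real (- lam * t powr \<nu>)))
      else 0)"

text \<open>The waiting times are indexed from 0: \<open>X 0\<close> is the first one.\<close>

definition arrival_time :: "(nat \<Rightarrow> 'a \<Rightarrow> real) \<Rightarrow> nat \<Rightarrow> 'a \<Rightarrow> real" where
  "arrival_time X m \<omega> = (\<Sum>i<m. X i \<omega>)"

text \<open>
  For i.i.d. positive waiting times the set below is almost surely finite; on the null event where
  it is infinite, \<open>Max\<close> has an unspecified value, which does not affect the state probabilities.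
\<close>

definition renewal_count :: "(nat \<Rightarrow> 'a \<Rightarrow> real) \<Rightarrow> real \<Rightarrow> 'a \<Rightarrow> nat" where
  "renewal_count X t \<omega> = Max {m. arrival_time X m \<omega> \<le> t}"

definition state_prob :: "'a measure \<Rightarrow> (nat \<Rightarrow> 'a \<Rightarrow> real) \<Rightarrow> nat \<Rightarrow> real \<Rightarrow> real" where
  "state_prob M X k t = measure M {\<omega> \<in> space M. renewal_count X t \<omega> = k}"

definition prabhakar_integrand ::
  "complex \<Rightarrow> complex \<Rightarrow> complex \<Rightarrow> complex \<Rightarrow> (real \<Rightarrow> complex) \<Rightarrow> real \<Rightarrow> real \<Rightarrow> complex" where
  "prabhakar_integrand \<rho> \<mu> \<omega> \<gamma> \<phi> x y =
     of_real (x - y) powr (\<mu> - 1) *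
     mittag_leffler3 \<rho> \<mu> \<gamma> (\<omega> * of_real (x - y) powr \<rho>) * \<phi> y"

definition prabhakar ::
  "complex \<Rightarrow> complex \<Rightarrow> complex \<Rightarrow> real \<Rightarrow> complex \<Rightarrow> (real \<Rightarrow> complex) \<Rightarrow> real \<Rightarrow> complex" where
  "prabhakar \<rho> \<mu> \<omega> a \<gamma> \<phi> x = (LBINT y:{a<..<x}. prabhakar_integrand \<rho> \<mu> \<omega> \<gamma> \<phi> x y)"

definition rl_integral :: "complex \<Rightarrow> (real \<Rightarrow> complex) \<Rightarrow> real \<Rightarrow> complex" where
  "rl_integral \<beta> g t =
     1 / Gamma \<beta> * (LBINT y:{0<..<t}. of_real (t - y) powr (\<beta> - 1) * g y)"

definition iter_deriv :: "nat \<Rightarrow> (real \<Rightarrow> complex) \<Rightarrow> real \<Rightarrow> complex" where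
  "iter_deriv n = (\<lambda>g t. vector_derivative g (at t)) ^^ n"

text \<open>For \<open>Re \<alpha> \<ge> 0\<close> this is the integer n with \<open>n - 1 \<le> Re \<alpha> < n\<close>.\<close>

definition rl_order :: "complex \<Rightarrow> nat" where
  "rl_order \<alpha> = nat \<lfloor>Re \<alpha>\<rfloor> + 1"

definition rl_derivative :: "complex \<Rightarrow> (real \<Rightarrow> complex) \<Rightarrow> real \<Rightarrow> complex" where
  "rl_derivative \<alpha> g =
     iter_deriv (rl_order \<alpha>) (rl_integral (of_nat (rl_order \<alpha>) - \<alpha>) g)"

text \<open>
  Integrals and derivatives are total in HOL; this states that those occurring in
  \<open>rl_derivative \<alpha> g t\<close> genuinely exist for every \<open>t > 0\<close>.
\<close>

definition rl_differentiable :: "complex \<Rightarrow> (real \<Rightarrow> complex) \<Rightarrow> bool" where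
  "rl_differentiable \<alpha> g \<longleftrightarrow>
     (\<forall>t>0. set_integrable lborel {0<..<t}
              (\<lambda>y. of_real (t - y) powr (of_nat (rl_order \<alpha>) - \<alpha> - 1) * g y) \<and>
            (\<forall>j<rl_order \<alpha>.
              iter_deriv j (rl_integral (of_nat (rl_order \<alpha>) - \<alpha>) g) differentiable (at t)))"

end

theory Submission
  imports Defs
begin

text \<open>
  Put \<open>K \<mu> \<xi> t = t\<^sup>\<mu>\<^sup>-\<^sup>1 E\<^sub>\<nu>\<^sub>,\<^sub>\<mu>\<^sup>\<xi> (- lam t\<^sup>\<nu>)\<close>. Expanding in powers of \<open>t\<close>, the Beta integral and
  Vandermonde's identity give the semigroup law \<open>K \<mu> \<xi> * K \<mu>' \<xi>' = K (\<mu> + \<mu>') (\<xi> + \<xi>')\<close> for the convolution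
  on \<open>(0, t)\<close>; moreover \<open>K (\<mu> + 1) \<xi>\<close> has derivative \<open>K \<mu> \<xi>\<close>. The waiting time density is
  \<open>lam\<^sup>\<delta> K (\<nu>\<delta>) \<delta>\<close>, fractional integration of order \<open>\<beta>\<close> is convolution with \<open>K \<beta> 0\<close> and the Prabhakar
  operator is convolution with \<open>K \<theta> (- \<delta>)\<close>, so every object of the theorem is a combination of
  kernels \<open>K\<close> whose parameters simply add up.

  The \<open>m\<close>-th arrival time has distribution function \<open>lam\<^sup>m\<^sup>\<delta> K (m\<nu>\<delta> + 1) (m\<delta>)\<close>, because the density is
  nonnegative: \<open>t K (\<nu>a) a t = a \<nu> (K 1 1 * K (\<nu>a) a) t\<close> excludes a first zero of \<open>K (\<nu>a) a\<close> as long as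
  \<open>K 1 1\<close> is positive, and \<open>K 1 1 = K (1 - \<nu>) 0 * K \<nu> 1\<close> then excludes a first zero of \<open>K 1 1\<close>.
\<close>

section \<open>The Beta integral with complex parameters\<close>

lemma set_integrable_Ioo_scale:
  fixes f :: "real \<Rightarrow> complex"
  assumes "t > 0"
  shows "set_integrable lborel {0<..<t} f \<longleftrightarrow> set_integrable lborel {0<..<1} (\<lambda>x. f (t * x))"
    and "(LBINT y:{0<..<t}. f y) = t *\<^sub>R (LBINT x:{0<..<1}. f (t * x))"
proof -
  have *: "indicator {0<..<t} (0 + t * x) = (indicator {0<..<1} x :: real)" for x
    using assms by (auto simp: indicator_def field_simps zero_less_mult_iff)
  show "set_integrable lborel {0<..<t} f \<longleftrightarrow> set_integrable lborel {0<..<1} (\<lambda>x. f (t * x))"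
    unfolding set_integrable_def using assms
    by (subst lborel_integrable_real_affine_iff[where c = t and t = 0, symmetric])
       (simp_all only: *, simp_all)
  show "(LBINT y:{0<..<t}. f y) = t *\<^sub>R (LBINT x:{0<..<1}. f (t * x))"
    unfolding set_lebesgue_integral_def using assms
    by (subst lborel_integral_real_affine[where c = t and t = 0]) (simp_all only: *, simp_all)
qed

text \<open>On the real axis the principal logarithm is \<open>ln \<bar>x\<bar>\<close>, plus
  \<open>\<i> * pi\<close> for negative \<open>x\<close>, so the power is a piecewise composition of
  measurable functions.\<close>

lemma borel_measurable_of_real_powr [measurable]:
  fixes z :: complex
  assumes "f \<in> borel_measurable M"
  shows "(\<lambda>x. complex_of_real (f x) powr z) \<in> borel_measurable M"
proof -
  have "of_real x powr z = (if x = 0 then 0 else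
      exp (z * (of_real (ln \<bar>x\<bar>) + (if x < 0 then \<i> * of_real pi else 0))))" for x :: real
    using Ln_of_real'[of x] by (auto simp: powr_def mult.commute)
  then show ?thesis using assms by simp
qed

lemma norm_powr_of_real: "x \<ge> 0 \<Longrightarrow> norm (of_real x powr (z::complex)) = x powr Re z"
  by (simp add: norm_powr_real_powr)

lemma norm_powr_one_minus: "x \<le> 1 \<Longrightarrow> norm ((1 - of_real x) powr (z::complex)) = (1 - x) powr Re z"
  using norm_powr_of_real[of "1 - x" z] by simp

text \<open>The modulus of the integrand is the real Beta integrand with parameters
  \<open>Re b\<close> and \<open>Re a\<close>.\<close>

lemma set_integrable_Beta_complex:
  fixes a b :: complex
  assumes "Re a > 0" "Re b > 0"
  shows "set_integrable lborel {0<..<1} (\<lambda>x. of_real (1 - x) powr (a - 1) * of_real x powr (b - 1))"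
proof -
  have "set_integrable lborel {0<..<1::real} (\<lambda>t. t powr (Re b - 1) * (1 - t) powr (Re a - 1))"
    by (rule set_integrable_subset[OF integrable_Beta]) (use assms in auto)
  then show ?thesis
    unfolding set_integrable_def
  proof (rule Bochner_Integration.integrable_bound)
    show "AE x in lborel. norm (indicat_real {0<..<1} x *\<^sub>R (of_real (1 - x) powr (a - 1) * of_real x powr (b - 1)))
      \<le> norm (indicat_real {0<..<1} x *\<^sub>R (x powr (Re b - 1) * (1 - x) powr (Re a - 1)))"
      using norm_powr_of_real[of "1 - _" "a - 1"]
      by (auto simp: indicator_def norm_mult norm_powr_of_real simp del: of_real_diff)
  qed measurable
qed

text \<open>Absolute integrability of the Gamma integrand refers to the completed measure; Borel
  measurability of the integrand brings it back to \<open>lborel\<close>.\<close>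

lemma Gamma_lebesgue_complex:
  assumes "Re z > 0"
  shows "set_integrable lborel {0<..} (\<lambda>t. complex_of_real t powr (z - 1) / of_real (exp t))"
    and "(LBINT t:{0<..}. complex_of_real t powr (z - 1) / of_real (exp t)) = Gamma z"
proof -
  have *: "set_borel_measurable borel {0<..} (\<lambda>t. complex_of_real t powr (z - 1) / of_real (exp t))"
    unfolding set_borel_measurable_def by (simp flip: exp_of_real) measurable
  show 1: "set_integrable lborel {0<..} (\<lambda>t. complex_of_real t powr (z - 1) / of_real (exp t))"
    using absolutely_integrable_Gamma_integral'[OF assms] *
    by (simp add: set_integrable_def set_borel_measurable_def integrable_completion)
  show "(LBINT t:{0<..}. complex_of_real t powr (z - 1) / of_real (exp t)) = Gamma z"
    using set_borel_integral_eq_integral(2)[OF 1] Gamma_integral_complex'[OF assms]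
    by (simp add: integral_unique)
qed

lemma powr_scale_Ioo:
  fixes a b :: complex
  assumes "t > 0" "x \<in> {0<..<1}"
  shows "of_real (t - t * x) powr (a - 1) * of_real (t * x) powr (b - 1) =
         of_real t powr (a + b - 2) * (of_real (1 - x) powr (a - 1) * of_real x powr (b - 1))"
proof -
  have 1: "of_real (t * y) powr c = of_real t powr c * of_real y powr c" if "y > 0"
    for y :: real and c :: complex
    using assms that by (simp add: powr_times_real)
  have 2: "of_real t powr (a + b - 2) = of_real t powr (a - 1) * of_real t powr (b - 1)"
    by (simp flip: powr_add add: algebra_simps)
  have 3: "t - t * x = t * (1 - x)" by (simp add: algebra_simps)
  have "of_real (t - t * x) powr (a - 1) = of_real t powr (a - 1) * of_real (1 - x) powr (a - 1)"
    unfolding 3 using assms by (intro 1) auto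
  moreover have "of_real (t * x) powr (b - 1) = of_real t powr (b - 1) * of_real x powr (b - 1)"
    using assms by (intro 1) auto
  ultimately show ?thesis by (simp only: 2 mult_ac)
qed

text \<open>Substitute \<open>y = t * x\<close>; the Jacobian raises the exponent
  \<open>a + b - 2\<close> to \<open>a + b - 1\<close>. The constant \<open>B\<close> stays an
  integral here because its evaluation as a Beta value relies on this very scaling.\<close>

lemma convolution_powr_aux:
  fixes a b :: complex
  assumes "Re a > 0" "Re b > 0" "t > 0"
  defines "B \<equiv> LBINT x:{0<..<1}. complex_of_real (1 - x) powr (a - 1) * of_real x powr (b - 1)"
  shows "set_integrable lborel {0<..<t} (\<lambda>y. of_real (t - y) powr (a - 1) * of_real y powr (b - 1))"
    and "(LBINT y:{0<..<t}. of_real (t - y) powr (a - 1) * of_real y powr (b - 1)) =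
         of_real t powr (a + b - 1) * B"
proof -
  note sc = powr_scale_Ioo[OF \<open>t > 0\<close>, of _ a b]
  have "set_integrable lborel {0<..<1} (\<lambda>x. complex_of_real (t - t * x) powr (a - 1) * of_real (t * x) powr (b - 1))
    \<longleftrightarrow> set_integrable lborel {0<..<1} (\<lambda>x. of_real t powr (a + b - 2) *
          (of_real (1 - x) powr (a - 1) * of_real x powr (b - 1)))"
    by (rule set_integrable_cong[OF refl refl sc])
  then show "set_integrable lborel {0<..<t} (\<lambda>y. of_real (t - y) powr (a - 1) * of_real y powr (b - 1))"
    using assms set_integrable_Beta_complex[OF assms(1,2)]
    by (subst set_integrable_Ioo_scale) auto
  have "(LBINT y:{0<..<t}. of_real (t - y) powr (a - 1) * of_real y powr (b - 1)) =
    t *\<^sub>R (LBINT x:{0<..<1}. of_real t powr (a + b - 2) *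
          (of_real (1 - x) powr (a - 1) * of_real x powr (b - 1)))"
    using assms by (subst set_integrable_Ioo_scale, simp) (intro arg_cong2[where f = scaleR] set_lebesgue_integral_cong refl, simp, use sc in blast)
  also have "\<dots> = (of_real t powr 1 * of_real t powr (a + b - 2)) * B"
    using assms by (simp add: B_def scaleR_conv_of_real)
  also have "of_real t powr 1 * of_real t powr (a + b - 2) = of_real t powr (a + b - 1)"
    by (subst powr_add[symmetric]) (simp add: algebra_simps)
  finally show "(LBINT y:{0<..<t}. of_real (t - y) powr (a - 1) * of_real y powr (b - 1)) =
         of_real t powr (a + b - 1) * B" .
qed

lemma not_nonpos_Ints_Re:
  fixes z :: complex
  shows "Re z > 0 \<Longrightarrow> z \<notin> \<int>\<^sub>\<le>\<^sub>0"
  by (auto elim!: nonpos_Ints_cases)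

text \<open>Euler's argument: by Fubini, \<open>Gamma a * Gamma b\<close> is the integral of the
  convolution of the two Gamma integrands. In that convolution the exponentials merge into
  \<open>exp (-t)\<close>, and the remaining power convolution scales to \<open>t\<close> to the
  power \<open>a + b - 1\<close> times the integral sought. Integrating over \<open>t\<close> gives
  \<open>Gamma (a + b)\<close> times that integral.\<close>

lemma Beta_lebesgue_complex:
  fixes a b :: complex
  assumes ab: "Re a > 0" "Re b > 0"
  shows "(LBINT x:{0<..<1}. complex_of_real (1 - x) powr (a - 1) * of_real x powr (b - 1)) = Beta a b"
    (is "?B = _")
proof -
  define g where "g = (\<lambda>(z::complex) t. indicator {0<..} t *\<^sub>R (complex_of_real t powr (z - 1) / of_real (exp t)))"
  have [measurable]: "g z \<in> borel_measurable borel" for z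
    unfolding g_def by measurable
  have gi: "integrable lborel (g z)" and gv: "integral\<^sup>L lborel (g z) = Gamma z" if "Re z > 0" for z
    using Gamma_lebesgue_complex[OF that] unfolding g_def set_integrable_def set_lebesgue_integral_def by auto
  have shift: "(LBINT t. f (t - v)) = (LBINT t. f t)" for f :: "real \<Rightarrow> 'b::{banach,second_countable_topology}" and v
    by (subst (2) lborel_integral_real_affine[where c = 1 and t = "- v"]) (simp_all add: algebra_simps)
  have shifti: "integrable lborel (\<lambda>t. f (t - v))" if "integrable lborel f" for f :: "real \<Rightarrow> complex" and v
    using lborel_integrable_real_affine[OF that, of 1 "- v"] by (simp add: algebra_simps)
  define F where "F = (\<lambda>(v, t). g b v * g a (t - v))"
  have "integrable (lborel \<Otimes>\<^sub>M lborel) F"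
  proof (rule lborel_pair.Fubini_integrable)
    show "F \<in> borel_measurable (lborel \<Otimes>\<^sub>M lborel)" unfolding F_def by measurable
    have "(\<lambda>v. LBINT t. norm (F (v, t))) = (\<lambda>v. norm (g b v) * (LBINT t. norm (g a t)))"
      using shift[of "\<lambda>t. norm (g a t)"] by (simp add: F_def norm_mult fun_eq_iff)
    then show "integrable lborel (\<lambda>v. LBINT t. norm (F (v, t)))"
      using gi[OF ab(2)] by simp
    show "AE v in lborel. integrable lborel (\<lambda>t. F (v, t))"
      using shifti[OF gi[OF ab(1)]] by (simp add: F_def)
  qed
  then have "(LBINT t. LBINT v. g b v * g a (t - v)) = (LBINT v. LBINT t. g b v * g a (t - v))"
    using lborel_pair.Fubini_integral[of "\<lambda>v t. g b v * g a (t - v)"] by (simp add: F_def)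
  also have "\<dots> = Gamma a * Gamma b"
    using ab by (simp add: shift gv)
  also have "(LBINT t. LBINT v. g b v * g a (t - v)) = (LBINT t. g (a + b) t * ?B)"
  proof (intro Bochner_Integration.integral_cong refl)
    fix t
    show "(LBINT v. g b v * g a (t - v)) = g (a + b) t * ?B"
  proof (cases "t > 0")
    case True
    have "(LBINT v. g b v * g a (t - v)) = (LBINT v:{0<..<t}. of_real (exp (-t)) * (of_real (t - v) powr (a - 1) * of_real v powr (b - 1)))"
      unfolding set_lebesgue_integral_def
      by (intro Bochner_Integration.integral_cong refl)
         (auto simp: g_def indicator_def exp_diff exp_minus field_simps)
    also have "\<dots> = of_real (exp (-t)) * (of_real t powr (a + b - 1) * ?B)"
      using convolution_powr_aux(2)[OF ab True] by simp
    finally show ?thesis using True by (simp add: g_def exp_minus field_simps)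
  next
    case False
    then have "(\<lambda>v. g b v * g a (t - v)) = (\<lambda>_. 0)" by (auto simp: g_def indicator_def fun_eq_iff)
    then show ?thesis using False by (simp add: g_def)
  qed
  qed
  also have "(LBINT t. g (a + b) t * ?B) = Gamma (a + b) * ?B"
    using ab by (simp add: gv)
  finally have "Gamma (a + b) * ?B = Gamma a * Gamma b" .
  moreover have "Gamma (a + b) \<noteq> 0"
    using ab by (simp add: Gamma_eq_zero_iff not_nonpos_Ints_Re)
  ultimately show ?thesis
    by (simp add: Beta_def field_simps)
qed

lemma convolution_powr:
  fixes a b :: complex
  assumes "Re a > 0" "Re b > 0" "t > 0"
  shows "(LBINT y:{0<..<t}. of_real (t - y) powr (a - 1) * of_real y powr (b - 1)) =
         of_real t powr (a + b - 1) * Beta a b"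
  using convolution_powr_aux(2)[OF assms] Beta_lebesgue_complex[OF assms(1,2)] by simp

text \<open>Powers normalised by 1/Gamma therefore keep this normalisation under
  convolution.\<close>

lemma rGamma_mult_Beta:
  fixes a b :: complex
  assumes "Re a > 0" "Re b > 0"
  shows "rGamma a * rGamma b * Beta a b = rGamma (a + b)"
proof -
  have "rGamma a \<noteq> 0" "rGamma b \<noteq> 0"
    using assms by (simp_all add: rGamma_eq_zero_iff not_nonpos_Ints_Re)
  then show ?thesis by (simp add: Beta_altdef Gamma_def field_simps)
qed

lemma Beta_lebesgue_real:
  fixes a b :: real
  assumes "a > 0" "b > 0"
  shows "set_integrable lborel {0<..<1} (\<lambda>t. t powr (a - 1) * (1 - t) powr (b - 1))"
    and "(LBINT t:{0<..<1}. t powr (a - 1) * (1 - t) powr (b - 1)) = Beta a b"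
proof -
  show 1: "set_integrable lborel {0<..<1} (\<lambda>t. t powr (a - 1) * (1 - t) powr (b - 1))"
    by (rule set_integrable_subset[OF integrable_Beta]) (use assms in auto)
  show "(LBINT t:{0<..<1}. t powr (a - 1) * (1 - t) powr (b - 1)) = Beta a b"
    using set_borel_integral_eq_integral(2)[OF 1] has_integral_Beta_real[of a b] assms
    by (simp add: has_integral_Icc_iff_Ioo integral_unique)
qed

section \<open>Growth of 1/Gamma along arithmetic progressions\<close>

lemma norm_Beta_le:
  fixes a b :: complex
  assumes "Re a > 0" "Re b > 0"
  shows "norm (Beta a b) \<le> Beta (Re a) (Re b)"
proof -
  have "norm (Beta a b) \<le> (LBINT x:{0<..<1}. x powr (Re b - 1) * (1 - x) powr (Re a - 1))"
    unfolding Beta_lebesgue_complex[OF assms, symmetric]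
    by (rule order_trans[OF set_integral_norm_bound[OF set_integrable_Beta_complex[OF assms]]])
       (intro eq_refl set_lebesgue_integral_cong, auto simp: norm_mult norm_powr_of_real norm_powr_one_minus)
  also have "\<dots> = Beta (Re b) (Re a)"
    by (rule Beta_lebesgue_real(2)) (use assms in auto)
  finally show ?thesis by (simp add: Beta_commute)
qed

text \<open>Controls the ratio of consecutive coefficients of the Mittag-Leffler series by a Beta
  value, which takes the place of Stirling's formula.\<close>

lemma norm_rGamma_add_le:
  fixes z :: complex and \<nu> :: real
  assumes "Re z > 0" "\<nu> > 0"
  shows "norm (rGamma (z + of_real \<nu>)) \<le> rGamma \<nu> * Beta (Re z) \<nu> * norm (rGamma z)"
proof -
  have "rGamma (z + of_real \<nu>) = rGamma z * of_real (rGamma \<nu>) * Beta z (of_real \<nu>)"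
    using rGamma_mult_Beta[of z "of_real \<nu>"] assms by (simp add: rGamma_complex_of_real)
  then have "norm (rGamma (z + of_real \<nu>)) = norm (rGamma z) * \<bar>rGamma \<nu>\<bar> * norm (Beta z (of_real \<nu>))"
    by (simp only: norm_mult norm_of_real)
  also have "\<dots> \<le> norm (rGamma z) * \<bar>rGamma \<nu>\<bar> * Beta (Re z) \<nu>"
    using norm_Beta_le[of z "of_real \<nu>"] assms by (intro mult_left_mono) auto
  also have "\<bar>rGamma \<nu>\<bar> = rGamma \<nu>"
    using Gamma_real_pos[OF assms(2)] by (simp add: rGamma_inverse_Gamma)
  finally show ?thesis by (simp only: mult_ac)
qed

text \<open>Dominated convergence in the Beta integral: for \<open>0 < t < 1\<close> the factor
  \<open>t powr (x * real r)\<close> tends to 0, and \<open>(1 - t) powr (\<nu> - 1)\<close>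
  dominates as soon as the exponent of \<open>t\<close> is nonnegative.\<close>

lemma Beta_tendsto_0:
  fixes x y \<nu> :: real
  assumes "\<nu> > 0" "x > 0"
  shows "(\<lambda>r. Beta (x * real r + y) \<nu>) \<longlonglongrightarrow> 0"
proof -
  have *: "(\<lambda>r. Beta (x * real r + y) \<nu>) \<longlonglongrightarrow> 0" if y: "y \<ge> 1" for y
  proof -
    have p: "x * real r + y > 0" for r using assms y by (simp add: add_nonneg_pos)
    have "(\<lambda>r. LBINT t. indicator {0<..<1} t *\<^sub>R (t powr (x * real r + y - 1) * (1 - t) powr (\<nu> - 1))) \<longlonglongrightarrow> (LBINT (t::real). 0)"
    proof (rule integral_dominated_convergence)
      show "integrable lborel (\<lambda>t. indicator {0<..<1} t *\<^sub>R (t powr (1 - 1) * (1 - t) powr (\<nu> - 1)))"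
        using Beta_lebesgue_real(1)[of 1 \<nu>] assms unfolding set_integrable_def by simp
      show "AE t in lborel. (\<lambda>r. indicator {0<..<1} t *\<^sub>R (t powr (x * real r + y - 1) * (1 - t) powr (\<nu> - 1))) \<longlonglongrightarrow> 0"
      proof (rule AE_I2)
        fix t :: real
        have "(\<lambda>r. (t powr x) ^ r * (t powr (y - 1) * (1 - t) powr (\<nu> - 1))) \<longlonglongrightarrow> 0" if "t \<in> {0<..<1}"
          using that assms powr_less_mono2[of x t 1]
          by (intro tendsto_mult_left_zero LIMSEQ_realpow_zero) auto
        moreover have "t powr (x * real r + y - 1) = (t powr x) ^ r * t powr (y - 1)" if "t \<in> {0<..<1}" for r
          using that by (simp add: powr_powr flip: powr_realpow powr_add) (simp add: algebra_simps)
        ultimately show "(\<lambda>r. indicator {0<..<1} t *\<^sub>R (t powr (x * real r + y - 1) * (1 - t) powr (\<nu> - 1))) \<longlonglongrightarrow> 0"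
          by (cases "t \<in> {0<..<1}") (auto simp: mult.assoc)
      qed
      show "AE t in lborel. norm (indicator {0<..<1} t *\<^sub>R (t powr (x * real r + y - 1) * (1 - t) powr (\<nu> - 1)))
          \<le> indicator {0<..<1} t *\<^sub>R (t powr (1 - 1) * (1 - t) powr (\<nu> - 1))" for r
      proof (rule AE_I2)
        fix t :: real
        have "0 \<le> x * real r + y - 1" using assms y by (simp add: add_nonneg_nonneg add_diff_eq[symmetric])
        then show "norm (indicator {0<..<1} t *\<^sub>R (t powr (x * real r + y - 1) * (1 - t) powr (\<nu> - 1)))
          \<le> indicator {0<..<1} t *\<^sub>R (t powr (1 - 1) * (1 - t) powr (\<nu> - 1))"
          by (auto simp: indicator_def intro!: mult_right_mono powr_le1)
      qed
    qed measurable
    then show ?thesis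
      using Beta_lebesgue_real(2)[OF p assms(1)] by (simp add: set_lebesgue_integral_def)
  qed
  \<comment> \<open>Skipping \<open>r0\<close> terms raises the offset \<open>y\<close> to at least
    1, the case already settled.\<close>
  define r0 where "r0 = nat \<lceil>(1 - y) / x\<rceil>"
  have "(1 - y) / x \<le> real r0" unfolding r0_def by linarith
  then have "x * real r0 + y \<ge> 1" using assms by (simp add: field_simps)
  from *[OF this] have "(\<lambda>r. Beta (x * real (r + r0) + y) \<nu>) \<longlonglongrightarrow> 0"
    by (simp add: algebra_simps)
  then show ?thesis by (rule LIMSEQ_offset)
qed

section \<open>Strict positivity of integrals, the first-zero principle and Vandermonde's
  identity\<close>

text \<open>If the integral were 0, the nonnegative integrand would vanish almost everywhere, and
  the interval, where it is positive, would be a null set.\<close>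

lemma set_lebesgue_integral_pos_Ioo:
  fixes f :: "real \<Rightarrow> real"
  assumes "t > 0" "set_integrable lborel {0<..<t} f" "\<And>y. 0 < y \<Longrightarrow> y < t \<Longrightarrow> f y > 0"
  shows "(LBINT y:{0<..<t}. f y) > 0"
proof -
  let ?g = "\<lambda>y. indicator {0<..<t} y *\<^sub>R f y"
  have i: "integrable lborel ?g" using assms(2) by (simp add: set_integrable_def)
  have nn: "AE y in lborel. 0 \<le> ?g y" using assms(3) by (auto simp: indicator_def intro: less_imp_le)
  have "integral\<^sup>L lborel ?g \<noteq> 0"
  proof
    assume "integral\<^sup>L lborel ?g = 0"
    with integral_nonneg_eq_0_iff_AE[OF i nn] have "AE y in lborel. ?g y = 0" by simp
    then have "AE y in lborel. y \<notin> {0<..<t}"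
      by eventually_elim (use assms(3) in \<open>force simp: indicator_def split: if_splits\<close>)
    then have "emeasure lborel {0<..<t} = 0"
      by (subst (asm) AE_iff_measurable[of "{0<..<t}"]) auto
    with assms(1) show False by simp
  qed
  with integral_nonneg_AE[OF nn] show ?thesis by (simp add: set_lebesgue_integral_def)
qed

text \<open>Otherwise the closed set where \<open>h\<close> is at most 0 has a least element. It is
  not 0, and \<open>h\<close> is positive before it, so \<open>step\<close> makes \<open>h\<close>
  positive there as well.\<close>

lemma positive_propagation:
  fixes h :: "real \<Rightarrow> real"
  assumes "continuous_on {0..T} h" "h 0 > 0"
    and step: "\<And>t. 0 < t \<Longrightarrow> t \<le> T \<Longrightarrow> (\<And>s. 0 \<le> s \<Longrightarrow> s < t \<Longrightarrow> h s > 0) \<Longrightarrow> h t > 0"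
    and "0 \<le> t" "t \<le> T"
  shows "h t > 0"
proof (rule ccontr)
  assume "\<not> h t > 0"
  define S where "S = {0..T} \<inter> h -` {..0}"
  have "closed S" unfolding S_def using assms(1) by (intro continuous_closed_preimage) auto
  moreover have "S \<noteq> {}" using \<open>\<not> h t > 0\<close> assms(4,5) by (auto simp: S_def)
  moreover have bdd: "bdd_below S" by (auto simp: S_def intro: bdd_belowI[of _ 0])
  ultimately have mem: "Inf S \<in> S" by (intro closed_contains_Inf)
  then have "Inf S \<noteq> 0" using assms(2) by (auto simp: S_def)
  moreover have "h s > 0" if "0 \<le> s" "s < Inf S" for s
  proof (rule ccontr)
    assume "\<not> h s > 0"
    with that mem have "s \<in> S" by (simp add: S_def)
    from cInf_lower[OF this bdd] that show False by simp
  qed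
  ultimately have "h (Inf S) > 0" using mem step[of "Inf S"] by (auto simp: S_def)
  with mem show False by (auto simp: S_def)
qed

lemma nn_integral_Ioo_eq:
  fixes f :: "real \<Rightarrow> real"
  assumes "set_integrable lborel {0<..<t} f" "\<And>y. 0 < y \<Longrightarrow> y < t \<Longrightarrow> 0 \<le> f y"
  shows "(\<integral>\<^sup>+y. ennreal (indicator {0<..<t} y * f y) \<partial>lborel) = ennreal (LBINT y:{0<..<t}. f y)"
  using assms unfolding set_integrable_def set_lebesgue_integral_def
  by (subst nn_integral_eq_integral) (auto simp: indicator_def)

text \<open>This compares the coefficients in the product of the binomial series of
  \<open>(1 - z)\<close> to the powers \<open>- \<xi>\<close> and \<open>- \<xi>'\<close>.\<close>

lemma pochhammer_vandermonde:
  fixes \<xi> \<xi>' :: complex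
  shows "(\<Sum>i\<le>n. pochhammer \<xi> i / fact i * (pochhammer \<xi>' (n - i) / fact (n - i))) = pochhammer (\<xi> + \<xi>') n / fact n"
proof -
  have "of_nat (n choose i) / fact n = 1 / (fact i * fact (n - i) :: complex)" if "i \<le> n" for i
    using that by (simp add: binomial_fact field_simps)
  then show ?thesis
    unfolding pochhammer_binomial_sum sum_divide_distrib
    by (intro sum.cong refl) (simp add: field_simps)
qed

section \<open>The Prabhakar kernel\<close>

locale prabhakar_kernel =
  fixes lam \<nu> :: real
  assumes lam_pos: "lam > 0" and nu_pos: "\<nu> > 0"
begin

section \<open>Convergence of the Mittag-Leffler series and of the kernel expansion\<close>

definition coeff :: "complex \<Rightarrow> complex \<Rightarrow> nat \<Rightarrow> complex" where
  "coeff \<mu> \<xi> r = pochhammer \<xi> r / fact r * rGamma (of_real \<nu> * of_nat r + \<mu>)"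

text \<open>The parameter \<open>\<mu>\<close> is arbitrary: fractional derivatives can lower it to
  nonpositive real part, where \<open>K\<close> need not be integrable at 0 but is still given by
  its series for \<open>t > 0\<close>.\<close>

definition K :: "complex \<Rightarrow> complex \<Rightarrow> real \<Rightarrow> complex" where
  "K \<mu> \<xi> t = of_real t powr (\<mu> - 1) *
     mittag_leffler3 (of_real \<nu>) \<mu> \<xi> (- of_real lam * of_real t powr of_real \<nu>)"

lemma mittag_leffler3_eq: "mittag_leffler3 (of_real \<nu>) \<mu> \<xi> z = (\<Sum>r. coeff \<mu> \<xi> r * z ^ r)"
  by (simp add: mittag_leffler3_def coeff_def)

text \<open>Ratio test: \<open>q r\<close> bounds the ratio of consecutive terms by
  \<open>norm_rGamma_add_le\<close>, and it tends to 0 with its Beta factor. The index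
  \<open>N\<close> also ensures the positive real part which that bound requires.\<close>

lemma summable_norm_coeff: "summable (\<lambda>r. norm (coeff \<mu> \<xi> r * z ^ r))"
proof -
  define q where "q = (\<lambda>r. norm ((\<xi> + of_nat r) / of_nat (Suc r)) *
    (rGamma \<nu> * Beta (\<nu> * real r + Re \<mu>) \<nu>) * norm z)"
  have "(\<lambda>r. (\<xi> + of_nat r) / of_nat (Suc r)) \<longlonglongrightarrow> 1"
  proof -
    have "(\<lambda>r. \<xi> / of_nat (Suc r) + of_nat r / of_nat (Suc r)) \<longlonglongrightarrow> 0 + 1"
      by (intro tendsto_add LIMSEQ_n_over_Suc_n LIMSEQ_Suc[OF lim_const_over_n])
    then show ?thesis by (simp add: add_divide_distrib)
  qed
  then have "q \<longlonglongrightarrow> norm (1::complex) * (rGamma \<nu> * 0) * norm z"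
    unfolding q_def by (intro tendsto_intros Beta_tendsto_0 nu_pos)
  then have "eventually (\<lambda>r. q r < 1/2) sequentially"
    by (rule order_tendstoD) simp
  moreover have "eventually (\<lambda>r. \<nu> * real r + Re \<mu> > 0) sequentially"
    using nu_pos by real_asymp
  ultimately have "eventually (\<lambda>r. q r < 1/2 \<and> \<nu> * real r + Re \<mu> > 0) sequentially"
    by eventually_elim simp
  then obtain N where N: "\<And>r. r \<ge> N \<Longrightarrow> q r < 1/2 \<and> \<nu> * real r + Re \<mu> > 0"
    unfolding eventually_sequentially by blast
  show ?thesis
  proof (rule summable_ratio_test[of "1/2" N])
    fix r assume "r \<ge> N"
    note r = N[OF this]
    have "coeff \<mu> \<xi> (Suc r) * z ^ Suc r = (pochhammer \<xi> r / fact r) * z ^ r *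
       ((\<xi> + of_nat r) / of_nat (Suc r) * z) * rGamma ((of_real \<nu> * of_nat r + \<mu>) + of_real \<nu>)"
      by (simp add: coeff_def pochhammer_Suc mult_ac distrib_left add_ac)
    then have "norm (coeff \<mu> \<xi> (Suc r) * z ^ Suc r) = norm (pochhammer \<xi> r / fact r) * norm z ^ r *
       (norm ((\<xi> + of_nat r) / of_nat (Suc r)) * norm z) * norm (rGamma ((of_real \<nu> * of_nat r + \<mu>) + of_real \<nu>))"
      by (simp only: norm_mult norm_power)
    also have "\<dots> \<le> norm (pochhammer \<xi> r / fact r) * norm z ^ r *
       (norm ((\<xi> + of_nat r) / of_nat (Suc r)) * norm z) *
       (rGamma \<nu> * Beta (\<nu> * real r + Re \<mu>) \<nu> * norm (rGamma (of_real \<nu> * of_nat r + \<mu>)))"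
      using norm_rGamma_add_le[of "of_real \<nu> * of_nat r + \<mu>" \<nu>] r nu_pos
      by (intro mult_left_mono) auto
    also have "\<dots> = q r * norm (coeff \<mu> \<xi> r * z ^ r)"
      by (simp add: q_def coeff_def norm_mult norm_divide norm_power mult_ac)
    also have "\<dots> \<le> 1/2 * norm (coeff \<mu> \<xi> r * z ^ r)"
      using r by (intro mult_right_mono) auto
    finally show "norm (norm (coeff \<mu> \<xi> (Suc r) * z ^ Suc r)) \<le> 1/2 * norm (norm (coeff \<mu> \<xi> r * z ^ r))"
      by simp
  qed simp
qed

lemma mittag_leffler3_sums: "(\<lambda>r. coeff \<mu> \<xi> r * z ^ r) sums mittag_leffler3 (of_real \<nu>) \<mu> \<xi> z"
  unfolding mittag_leffler3_eq
  by (intro summable_sums summable_norm_cancel[OF summable_norm_coeff])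

text \<open>The \<open>r\<close>-th term of \<open>K \<mu> \<xi> t\<close> with all powers of
  \<open>t\<close> merged into one, the form to which the Beta integral applies.\<close>

definition summand :: "complex \<Rightarrow> complex \<Rightarrow> nat \<Rightarrow> real \<Rightarrow> complex" where
  "summand \<mu> \<xi> r t = pochhammer \<xi> r / fact r * (- of_real lam) ^ r *
     rGamma (of_real \<nu> * of_nat r + \<mu>) * of_real t powr (of_real \<nu> * of_nat r + \<mu> - 1)"

lemma summand_eq:
  assumes "t > 0"
  shows "summand \<mu> \<xi> r t =
    of_real t powr (\<mu> - 1) * (coeff \<mu> \<xi> r * (- of_real lam * of_real t powr of_real \<nu>) ^ r)"
proof -
  have "of_real t powr (of_real \<nu> * of_nat r + \<mu> - 1) =
      complex_of_real t powr (of_nat r * of_real \<nu>) * of_real t powr (\<mu> - 1)"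
    by (simp flip: powr_add add: algebra_simps)
  also have "complex_of_real t powr (of_nat r * of_real \<nu>) = (of_real t powr of_real \<nu>) ^ r"
    using assms by (simp add: powr_def exp_of_nat_mult[symmetric] mult_ac)
  finally show ?thesis
    by (simp only: summand_def coeff_def power_mult_distrib mult_ac)
qed

lemma K_sums: "t > 0 \<Longrightarrow> (\<lambda>r. summand \<mu> \<xi> r t) sums K \<mu> \<xi> t"
  unfolding K_def summand_eq by (intro sums_mult mittag_leffler3_sums)

lemma summable_norm_summand: "t > 0 \<Longrightarrow> summable (\<lambda>r. norm (summand \<mu> \<xi> r t))"
  unfolding summand_eq norm_mult[of "_ powr _"] by (intro summable_mult summable_norm_coeff)

text \<open>As \<open>\<nu> > 0\<close>, the argument of the series is largest in modulus at
  \<open>t = b\<close>; only the prefactor is singular at 0. This supplies the majorants for the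
  convolution.\<close>

lemma suminf_norm_summand_le:
  obtains C where "C \<ge> 0" and "\<And>t. 0 < t \<Longrightarrow> t \<le> b \<Longrightarrow> (\<Sum>r. norm (summand \<mu> \<xi> r t)) \<le> C * t powr (Re \<mu> - 1)"
proof
  define C where "C = (\<Sum>r. norm (coeff \<mu> \<xi> r * (of_real lam * of_real (b powr \<nu>)) ^ r))"
  show "C \<ge> 0" unfolding C_def by (intro suminf_nonneg summable_norm_coeff) auto
  fix t :: real assume t: "0 < t" "t \<le> b"
  have "(\<Sum>r. norm (summand \<mu> \<xi> r t)) \<le> (\<Sum>r. t powr (Re \<mu> - 1) * norm (coeff \<mu> \<xi> r * (of_real lam * of_real (b powr \<nu>)) ^ r))"
  proof (intro suminf_le summable_norm_summand summable_mult summable_norm_coeff t)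
    fix r
    have "norm (- of_real lam * of_real t powr of_real \<nu> :: complex) \<le> norm (of_real lam * of_real (b powr \<nu>) :: complex)"
      using t nu_pos lam_pos by (simp add: norm_mult norm_powr_of_real powr_mono2)
    then show "norm (summand \<mu> \<xi> r t) \<le> t powr (Re \<mu> - 1) * norm (coeff \<mu> \<xi> r * (of_real lam * of_real (b powr \<nu>)) ^ r)"
      using t unfolding summand_eq[OF t(1)] norm_mult[of "_ powr _"] norm_mult[of "coeff _ _ _"] norm_power
      by (simp only: norm_powr_of_real[of t] minus_complex.simps one_complex.simps) (intro mult_left_mono power_mono, auto)
  qed
  also have "\<dots> = C * t powr (Re \<mu> - 1)"
    unfolding C_def by (subst suminf_mult[OF summable_norm_coeff]) simp
  finally show "(\<Sum>r. norm (summand \<mu> \<xi> r t)) \<le> C * t powr (Re \<mu> - 1)" .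
qed

lemma measurable_summand [measurable]: "summand \<mu> \<xi> r \<in> borel_measurable borel"
  unfolding summand_def by measurable

section \<open>The semigroup law\<close>

text \<open>The Beta value of the power convolution is absorbed by \<open>rGamma_mult_Beta\<close>.
  What remains depends on \<open>r\<close> and \<open>s\<close> only through \<open>r + s\<close>,
  apart from the Pochhammer factors.\<close>

lemma set_integral_summand_mult:
  assumes "Re \<mu> > 0" "Re \<mu>' > 0" "t > 0"
  shows "set_integrable lborel {0<..<t} (\<lambda>y. summand \<mu> \<xi> r (t - y) * summand \<mu>' \<xi>' s y)"
    and "(LBINT y:{0<..<t}. summand \<mu> \<xi> r (t - y) * summand \<mu>' \<xi>' s y) =
      (pochhammer \<xi> r / fact r) * (pochhammer \<xi>' s / fact s) * (- of_real lam) ^ (r + s) *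
      rGamma (of_real \<nu> * of_nat (r + s) + (\<mu> + \<mu>')) * of_real t powr (of_real \<nu> * of_nat (r + s) + (\<mu> + \<mu>') - 1)"
proof -
  let ?a = "of_real \<nu> * of_nat r + \<mu>" and ?b = "of_real \<nu> * of_nat s + \<mu>'"
  let ?C = "(pochhammer \<xi> r / fact r) * (pochhammer \<xi>' s / fact s) * (- of_real lam) ^ (r + s) * rGamma ?a * rGamma ?b"
  have ab: "Re ?a > 0" "Re ?b > 0" using assms nu_pos by (auto intro: add_nonneg_pos)
  have eq: "summand \<mu> \<xi> r (t - y) * summand \<mu>' \<xi>' s y =
      ?C * (of_real (t - y) powr (?a - 1) * of_real y powr (?b - 1))" for y
    by (simp add: summand_def power_add mult_ac)
  show "set_integrable lborel {0<..<t} (\<lambda>y. summand \<mu> \<xi> r (t - y) * summand \<mu>' \<xi>' s y)"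
    unfolding eq using convolution_powr_aux(1)[OF ab assms(3)] by (rule set_integrable_mult_right)
  have "(LBINT y:{0<..<t}. summand \<mu> \<xi> r (t - y) * summand \<mu>' \<xi>' s y) =
    ?C * (of_real t powr (?a + ?b - 1) * Beta ?a ?b)"
    unfolding eq using convolution_powr[OF ab assms(3)] by simp
  also have "\<dots> = (pochhammer \<xi> r / fact r) * (pochhammer \<xi>' s / fact s) * (- of_real lam) ^ (r + s) *
      rGamma (?a + ?b) * of_real t powr (?a + ?b - 1)"
    unfolding rGamma_mult_Beta[OF ab, symmetric] by (simp add: mult_ac)
  finally show "(LBINT y:{0<..<t}. summand \<mu> \<xi> r (t - y) * summand \<mu>' \<xi>' s y) =
      (pochhammer \<xi> r / fact r) * (pochhammer \<xi>' s / fact s) * (- of_real lam) ^ (r + s) *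
      rGamma (of_real \<nu> * of_nat (r + s) + (\<mu> + \<mu>')) * of_real t powr (of_real \<nu> * of_nat (r + s) + (\<mu> + \<mu>') - 1)"
    by (simp add: algebra_simps)
qed

text \<open>The Cauchy product of the two series is integrated term by term using dominated
  convergence. On each diagonal \<open>r + s = k\<close> the Pochhammer factors add up by
  Vandermonde's identity.\<close>

lemma K_convolution:
  assumes "Re \<mu> > 0" "Re \<mu>' > 0" "t > 0"
  shows "set_integrable lborel {0<..<t} (\<lambda>y. K \<mu> \<xi> (t - y) * K \<mu>' \<xi>' y)" (is ?int)
    and "(LBINT y:{0<..<t}. K \<mu> \<xi> (t - y) * K \<mu>' \<xi>' y) = K (\<mu> + \<mu>') (\<xi> + \<xi>') t" (is ?val)
proof -
  define a where "a = (\<lambda>y r. summand \<mu> \<xi> r (t - y))"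
  define b where "b = (\<lambda>y r. summand \<mu>' \<xi>' r y)"
  define S where "S = (\<lambda>n y. \<Sum>k<n. \<Sum>i\<le>k. a y i * b y (k - i))"
  obtain C where C: "C \<ge> 0" "\<And>s. 0 < s \<Longrightarrow> s \<le> t \<Longrightarrow> (\<Sum>r. norm (summand \<mu> \<xi> r s)) \<le> C * s powr (Re \<mu> - 1)"
    using suminf_norm_summand_le by blast
  obtain D where D: "D \<ge> 0" "\<And>s. 0 < s \<Longrightarrow> s \<le> t \<Longrightarrow> (\<Sum>r. norm (summand \<mu>' \<xi>' r s)) \<le> D * s powr (Re \<mu>' - 1)"
    using suminf_norm_summand_le by blast
  \<comment> \<open>The product of the two majorants: a multiple of a Beta integrand, integrable
    because both real parts are positive.\<close>
  define w where "w = (\<lambda>y. C * D * ((t - y) powr (Re \<mu> - 1) * y powr (Re \<mu>' - 1)))"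
  have [measurable]: "(\<lambda>y. a y r) \<in> borel_measurable borel" "(\<lambda>y. b y r) \<in> borel_measurable borel" for r
    unfolding a_def b_def by measurable
  have lim: "(\<lambda>n. S n y) \<longlonglongrightarrow> K \<mu> \<xi> (t - y) * K \<mu>' \<xi>' y" if "y \<in> {0<..<t}" for y
  proof -
    have "(\<lambda>k. \<Sum>i\<le>k. a y i * b y (k - i)) sums ((\<Sum>i. a y i) * (\<Sum>i. b y i))"
      unfolding a_def b_def using that by (intro Cauchy_product_sums summable_norm_summand) auto
    then show ?thesis
      using that sums_unique[OF K_sums[of "t - y" \<mu> \<xi>]] sums_unique[OF K_sums[of y \<mu>' \<xi>']]
      unfolding S_def a_def b_def by (simp add: sums_def)
  qed
  have bound: "norm (S n y) \<le> w y" if "y \<in> {0<..<t}" for n y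
  proof -
    have sa: "summable (\<lambda>i. norm (a y i))" and sb: "summable (\<lambda>i. norm (b y i))"
      unfolding a_def b_def using that by (auto intro!: summable_norm_summand)
    have "norm (S n y) \<le> (\<Sum>k<n. \<Sum>i\<le>k. norm (a y i) * norm (b y (k - i)))"
      unfolding S_def by (intro order_trans[OF norm_sum] sum_mono) (simp add: norm_mult)
    also have "\<dots> \<le> (\<Sum>k. \<Sum>i\<le>k. norm (a y i) * norm (b y (k - i)))"
      using summable_Cauchy_product[of "\<lambda>i. norm (a y i)" "\<lambda>i. norm (b y i)"] sa sb
      by (intro sum_le_suminf) (auto intro!: sum_nonneg)
    also have "\<dots> = (\<Sum>i. norm (a y i)) * (\<Sum>i. norm (b y i))"
      using Cauchy_product[of "\<lambda>i. norm (a y i)" "\<lambda>i. norm (b y i)"] sa sb by simp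
    also have "\<dots> \<le> (C * (t - y) powr (Re \<mu> - 1)) * (D * y powr (Re \<mu>' - 1))"
      using that C D sb unfolding a_def b_def by (intro mult_mono suminf_nonneg) auto
    finally show ?thesis by (simp add: w_def mult_ac)
  qed
  have lims: "AE y in lborel. (\<lambda>n. indicator {0<..<t} y *\<^sub>R S n y) \<longlonglongrightarrow>
      indicator {0<..<t} y *\<^sub>R (K \<mu> \<xi> (t - y) * K \<mu>' \<xi>' y)"
    using lim by (auto simp: indicator_def)
  have meas: "(\<lambda>y. indicator {0<..<t} y *\<^sub>R S n y) \<in> borel_measurable lborel" for n
    unfolding S_def by measurable
  \<comment> \<open>Measurability of the product of kernels is inherited from the partial sums,
    whose pointwise limit it is.\<close>
  have meas': "(\<lambda>y. indicator {0<..<t} y *\<^sub>R (K \<mu> \<xi> (t - y) * K \<mu>' \<xi>' y)) \<in> borel_measurable lborel"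
    by (rule borel_measurable_LIMSEQ_metric[where f = "\<lambda>n y. indicator {0<..<t} y *\<^sub>R S n y", OF meas]) (use lim in \<open>auto simp: indicator_def\<close>)
  have w: "integrable lborel (\<lambda>y. indicator {0<..<t} y *\<^sub>R w y)"
  proof -
    have "set_integrable lborel {0<..<t} (\<lambda>y. C * D * norm (of_real (t - y) powr (\<mu> - 1) * of_real y powr (\<mu>' - 1) :: complex))"
      using set_integrable_norm[OF convolution_powr_aux(1)[OF assms]] by (rule set_integrable_mult_right)
    also have "?this \<longleftrightarrow> set_integrable lborel {0<..<t} w"
      by (rule set_integrable_cong) (auto simp: w_def norm_mult norm_powr_of_real simp flip: of_real_diff)
    finally show ?thesis by (simp add: set_integrable_def)
  qed
  have bd: "AE y in lborel. norm (indicator {0<..<t} y *\<^sub>R S n y) \<le> indicator {0<..<t} y *\<^sub>R w y" for n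
    using bound by (auto simp: indicator_def)
  note dom = meas' meas w lims bd
  show ?int unfolding set_integrable_def by (rule integrable_dominated_convergence[OF dom])
  have L1: "(\<lambda>n. LBINT y:{0<..<t}. S n y) \<longlonglongrightarrow> (LBINT y:{0<..<t}. K \<mu> \<xi> (t - y) * K \<mu>' \<xi>' y)"
    unfolding set_lebesgue_integral_def by (rule integral_dominated_convergence[OF dom])
  have int1: "set_integrable lborel {0<..<t} (\<lambda>y. a y i * b y j)" for i j
    unfolding a_def b_def by (rule set_integral_summand_mult[OF assms])
  have "(LBINT y:{0<..<t}. S n y) = (\<Sum>k<n. summand (\<mu> + \<mu>') (\<xi> + \<xi>') k t)" for n
  proof -
    have "(LBINT y:{0<..<t}. S n y) = (\<Sum>k<n. \<Sum>i\<le>k. LBINT y:{0<..<t}. a y i * b y (k - i))"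
      using int1 unfolding S_def set_lebesgue_integral_def set_integrable_def scaleR_sum_right
      by (subst Bochner_Integration.integral_sum; (intro sum.cong refl Bochner_Integration.integral_sum Bochner_Integration.integrable_sum)?) auto
    also have "\<dots> = (\<Sum>k<n. (\<Sum>i\<le>k. pochhammer \<xi> i / fact i * (pochhammer \<xi>' (k - i) / fact (k - i))) *
      ((- of_real lam) ^ k * rGamma (of_real \<nu> * of_nat k + (\<mu> + \<mu>')) * of_real t powr (of_real \<nu> * of_nat k + (\<mu> + \<mu>') - 1)))"
      unfolding sum_distrib_right a_def b_def
      by (intro sum.cong refl, subst set_integral_summand_mult(2)[OF assms]) (simp add: mult.assoc)
    also have "\<dots> = (\<Sum>k<n. summand (\<mu> + \<mu>') (\<xi> + \<xi>') k t)"
      by (simp only: pochhammer_vandermonde summand_def mult.assoc)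
    finally show ?thesis .
  qed
  with L1 have "(\<lambda>k. summand (\<mu> + \<mu>') (\<xi> + \<xi>') k t) sums (LBINT y:{0<..<t}. K \<mu> \<xi> (t - y) * K \<mu>' \<xi>' y)"
    by (simp add: sums_def)
  with K_sums[OF assms(3)] show ?val by (rule sums_unique2[symmetric])
qed


section \<open>Derivative and special identities of the kernel\<close>

lemma summable_coeff: "summable (\<lambda>r. coeff \<mu> \<xi> r * z ^ r)"
  by (rule summable_norm_cancel[OF summable_norm_coeff])

text \<open>The recurrence \<open>z * rGamma (z + 1) = rGamma z\<close> also holds at the poles of
  Gamma, so every \<open>\<mu>\<close> is covered.\<close>

lemma coeff_plus1: "(of_real \<nu> * of_nat r + \<mu>) * coeff (\<mu> + 1) \<xi> r = coeff \<mu> \<xi> r"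
  using rGamma_plus1[of "of_real \<nu> * of_nat r + \<mu>"] by (simp add: coeff_def add.assoc mult.left_commute)

lemma has_field_derivative_mittag_leffler3:
  "(mittag_leffler3 (of_real \<nu>) \<mu> \<xi> has_field_derivative (\<Sum>r. diffs (coeff \<mu> \<xi>) r * z ^ r)) (at z)"
  unfolding mittag_leffler3_eq[abs_def]
  by (rule termdiffs_strong_converges_everywhere[OF summable_coeff])

text \<open>The \<open>diffs\<close> series is the derivative, so the left side applies the operator
  \<open>\<mu> + \<nu> z d/dz\<close>, which multiplies the coefficient of \<open>z ^ r\<close> by
  \<open>\<nu> r + \<mu>\<close>.\<close>

lemma mittag_leffler3_diffs:
  "\<mu> * mittag_leffler3 (of_real \<nu>) (\<mu> + 1) \<xi> z + of_real \<nu> * z * (\<Sum>r. diffs (coeff (\<mu> + 1) \<xi>) r * z ^ r)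
    = mittag_leffler3 (of_real \<nu>) \<mu> \<xi> z"
proof -
  let ?c = "coeff (\<mu> + 1) \<xi>"
  have "(\<lambda>r. of_nat r * ?c r * z ^ (r - Suc 0)) sums (\<Sum>r. diffs ?c r * z ^ r)"
    by (rule diffs_equiv[OF termdiff_converges_all[OF summable_coeff]])
  from sums_add[OF sums_mult[OF mittag_leffler3_sums] sums_mult[OF this]]
  have "(\<lambda>r. \<mu> * (?c r * z ^ r) + of_real \<nu> * z * (of_nat r * ?c r * z ^ (r - Suc 0))) sums
      (\<mu> * mittag_leffler3 (of_real \<nu>) (\<mu> + 1) \<xi> z + of_real \<nu> * z * (\<Sum>r. diffs ?c r * z ^ r))" .
  also have "(\<lambda>r. \<mu> * (?c r * z ^ r) + of_real \<nu> * z * (of_nat r * ?c r * z ^ (r - Suc 0))) = (\<lambda>r. coeff \<mu> \<xi> r * z ^ r)"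
  proof
    fix r
    have "\<mu> * (?c r * z ^ r) + of_real \<nu> * z * (of_nat r * ?c r * z ^ (r - Suc 0)) =
        (of_real \<nu> * of_nat r + \<mu>) * ?c r * z ^ r"
      \<comment> \<open>At \<open>r = 0\<close> the truncated exponent \<open>r - Suc 0\<close> is
        harmless, since the factor \<open>of_nat r\<close> vanishes.\<close>
      by (cases r) (simp_all add: algebra_simps)
    then show "\<mu> * (?c r * z ^ r) + of_real \<nu> * z * (of_nat r * ?c r * z ^ (r - Suc 0)) = coeff \<mu> \<xi> r * z ^ r"
      by (simp only: coeff_plus1)
  qed
  finally show ?thesis
    using mittag_leffler3_sums by (rule sums_unique2)
qed

text \<open>The kernel extends holomorphically near a positive \<open>t\<close>, off the branch cut.
  The chain rule there, with \<open>w powr (\<mu> - 1)\<close> factored out, leaves the operator of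
  \<open>mittag_leffler3_diffs\<close>; the derivative is then restricted to the real line.\<close>

lemma K_has_vector_derivative:
  assumes "t > 0"
  shows "(K (\<mu> + 1) \<xi> has_vector_derivative K \<mu> \<xi> t) (at t)"
proof -
  let ?w = "complex_of_real t" and ?D = "\<lambda>z. \<Sum>r. diffs (coeff (\<mu> + 1) \<xi>) r * z ^ r"
  let ?z = "- of_real lam * ?w powr of_real \<nu>"
  have "((\<lambda>w. w powr \<mu> * mittag_leffler3 (of_real \<nu>) (\<mu> + 1) \<xi> (- of_real lam * w powr of_real \<nu>))
     has_field_derivative (\<mu> * ?w powr (\<mu> - 1) * mittag_leffler3 (of_real \<nu>) (\<mu> + 1) \<xi> ?z +
       ?w powr \<mu> * (?D ?z * (- of_real lam * (of_real \<nu> * ?w powr (of_real \<nu> - 1)))))) (at ?w)"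
    using assms
    by (auto intro!: derivative_eq_intros DERIV_chain2[OF has_field_derivative_mittag_leffler3] simp: mult_ac)
  also have "?w powr \<mu> * (?D ?z * (- of_real lam * (of_real \<nu> * ?w powr (of_real \<nu> - 1)))) =
      ?w powr (\<mu> - 1) * (of_real \<nu> * ?z * ?D ?z)"
    using assms by (simp add: powr_diff field_simps)
  finally have "((\<lambda>w. w powr \<mu> * mittag_leffler3 (of_real \<nu>) (\<mu> + 1) \<xi> (- of_real lam * w powr of_real \<nu>))
     has_field_derivative (?w powr (\<mu> - 1) * (\<mu> * mittag_leffler3 (of_real \<nu>) (\<mu> + 1) \<xi> ?z + of_real \<nu> * ?z * ?D ?z))) (at ?w)"
    by (simp only: distrib_left mult_ac)
  then show ?thesis
    unfolding mittag_leffler3_diffs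
    by (simp only: K_def[abs_def] add_diff_cancel_right') (rule has_vector_derivative_real_field)
qed

text \<open>\<open>pochhammer 0 r\<close> vanishes for \<open>r > 0\<close>, so only the constant
  term survives: \<open>K \<mu> 0\<close> is the Riemann-Liouville kernel.\<close>

lemma K_xi_0: "K \<mu> 0 t = of_real t powr (\<mu> - 1) * rGamma \<mu>"
proof -
  have "mittag_leffler3 (of_real \<nu>) \<mu> 0 z = rGamma \<mu>" for z
    unfolding mittag_leffler3_eq by (subst suminf_finite[of "{0}"]) (auto simp: coeff_def pochhammer_0_left)
  then show ?thesis by (simp add: K_def)
qed

text \<open>Holds term by term, from the recurrence of 1/Gamma at \<open>\<nu> (r + a)\<close> and
  \<open>a (a + 1)_r = (a + r) (a)_r\<close>. By the semigroup law the right side is a multiple of a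
  convolution with \<open>K 1 1\<close>.\<close>

lemma of_real_mult_K:
  assumes "t > 0"
  shows "of_real t * K (of_real \<nu> * a) a t = a * of_real \<nu> * K (of_real \<nu> * a + 1) (a + 1) t"
proof -
  have "of_real t * summand (of_real \<nu> * a) a r t = a * of_real \<nu> * summand (of_real \<nu> * a + 1) (a + 1) r t" for r
  proof -
    let ?s = "of_real \<nu> * of_nat r + of_real \<nu> * a"
    have 1: "rGamma ?s = of_real \<nu> * (of_nat r + a) * rGamma (?s + 1)"
      using rGamma_plus1[of ?s] by (simp add: algebra_simps)
    have 2: "a * pochhammer (a + 1) r = (of_nat r + a) * pochhammer a r"
      using pochhammer_rec[of a r] pochhammer_Suc[of a r] by (simp add: mult_ac add_ac)
    have 3: "of_real t powr ?s = of_real t * of_real t powr (?s - 1)"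
      using assms by (simp add: powr_diff)
    have "of_real t * summand (of_real \<nu> * a) a r t =
      of_real \<nu> * ((of_nat r + a) * pochhammer a r) / fact r * (- of_real lam) ^ r * rGamma (?s + 1) * of_real t powr ?s"
      unfolding summand_def 1 3 by (simp add: mult_ac)
    also have "\<dots> = a * of_real \<nu> * summand (of_real \<nu> * a + 1) (a + 1) r t"
      unfolding summand_def 2[symmetric] by (simp add: add.assoc mult_ac)
    finally show ?thesis .
  qed
  with sums_mult[OF K_sums[OF assms], of "of_real t" "of_real \<nu> * a" a]
  have "(\<lambda>r. a * of_real \<nu> * summand (of_real \<nu> * a + 1) (a + 1) r t) sums (of_real t * K (of_real \<nu> * a) a t)"
    by simp
  with sums_mult[OF K_sums[OF assms]] show ?thesis by (rule sums_unique2[symmetric])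
qed

section \<open>Real parameters and positivity of the kernels\<close>

text \<open>Split off from \<open>K_real\<close> because it is continuous up to
  \<open>t = 0\<close>, where the kernel may blow up; the first-zero arguments run on this
  factor.\<close>

definition E_real :: "real \<Rightarrow> real \<Rightarrow> real \<Rightarrow> real" where
  "E_real m x t = Re (mittag_leffler3 (of_real \<nu>) (of_real m) (of_real x) (of_real (- lam * t powr \<nu>)))"

definition K_real :: "real \<Rightarrow> real \<Rightarrow> real \<Rightarrow> real" where
  "K_real m x t = t powr (m - 1) * E_real m x t"

lemma mittag_leffler3_of_real:
  "Im (mittag_leffler3 (of_real \<nu>) (of_real m) (of_real x) (of_real z)) = 0"
proof -
  have *: "coeff (of_real m) (of_real x) r * of_real z ^ r =
      of_real (pochhammer x r / fact r * rGamma (\<nu> * real r + m) * z ^ r)" for r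
    by (simp add: coeff_def pochhammer_of_real rGamma_complex_of_real[symmetric])
  with sums_Im[OF mittag_leffler3_sums[of "of_real m" "of_real x" "of_real z"]]
  have "(\<lambda>r. 0) sums Im (mittag_leffler3 (of_real \<nu>) (of_real m) (of_real x) (of_real z))"
    unfolding * by (simp only: Im_complex_of_real)
  then show ?thesis by (simp add: sums_iff)
qed

lemma K_of_real:
  assumes "t > 0"
  shows "K (of_real m) (of_real x) t = of_real (K_real m x t)"
proof -
  have 1: "- complex_of_real lam * of_real t powr of_real \<nu> = of_real (- lam * t powr \<nu>)"
    using assms by (simp add: powr_of_real)
  have 2: "complex_of_real t powr (of_real m - 1) = of_real (t powr (m - 1))"
    using assms powr_of_real[of t "m - 1"] by simp
  have 3: "mittag_leffler3 (of_real \<nu>) (of_real m) (of_real x) (of_real (- lam * t powr \<nu>)) = of_real (E_real m x t)"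
    unfolding E_real_def using mittag_leffler3_of_real by (simp only: complex_eq_iff) simp
  show ?thesis
    unfolding K_def K_real_def 1 2 3 by simp
qed

lemma K_real_convolution:
  assumes "m > 0" "m' > 0" "t > 0"
  shows "set_integrable lborel {0<..<t} (\<lambda>y. K_real m x (t - y) * K_real m' x' y)"
    and "(LBINT y:{0<..<t}. K_real m x (t - y) * K_real m' x' y) = K_real (m + m') (x + x') t"
proof -
  note c = K_convolution[of "of_real m" "of_real m'" t "of_real x" "of_real x'"]
  have eq: "K (of_real m) (of_real x) (t - y) * K (of_real m') (of_real x') y =
      of_real (K_real m x (t - y) * K_real m' x' y)" if "y \<in> {0<..<t}" for y
    using that by (simp add: K_of_real)
  have i: "set_integrable lborel {0<..<t} (\<lambda>y. complex_of_real (K_real m x (t - y) * K_real m' x' y))"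
  proof -
    have "?thesis \<longleftrightarrow> set_integrable lborel {0<..<t} (\<lambda>y. K (of_real m) (of_real x) (t - y) * K (of_real m') (of_real x') y)"
      by (rule set_integrable_cong[OF refl refl]) (simp only: eq)
    then show ?thesis using c(1) assms by simp
  qed
  then show "set_integrable lborel {0<..<t} (\<lambda>y. K_real m x (t - y) * K_real m' x' y)"
    unfolding set_integrable_def by (drule_tac integrable_Re) simp
  have "of_real (LBINT y:{0<..<t}. K_real m x (t - y) * K_real m' x' y) =
      (LBINT y:{0<..<t}. complex_of_real (K_real m x (t - y) * K_real m' x' y))"
    by (rule set_integral_complex_of_real[symmetric])
  also have "\<dots> = (LBINT y:{0<..<t}. K (of_real m) (of_real x) (t - y) * K (of_real m') (of_real x') y)"
    by (intro set_lebesgue_integral_cong) (auto simp: eq)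
  also have "\<dots> = of_real (K_real (m + m') (x + x') t)"
    using c(2) assms K_of_real[of t "m + m'" "x + x'"] by simp
  finally show "(LBINT y:{0<..<t}. K_real m x (t - y) * K_real m' x' y) = K_real (m + m') (x + x') t"
    by (simp only: of_real_eq_iff)
qed

lemma continuous_on_E_real: "continuous_on {0..} (E_real m x)"
proof -
  have "continuous_on UNIV (mittag_leffler3 (of_real \<nu>) (of_real m) (of_real x))"
    by (rule DERIV_continuous_on) (rule has_field_derivative_at_within[OF has_field_derivative_mittag_leffler3])
  moreover have "continuous_on {0..} (\<lambda>t. complex_of_real (- lam * t powr \<nu>))"
    using nu_pos by (intro continuous_intros continuous_on_powr') auto
  ultimately show ?thesis unfolding E_real_def[abs_def]
    by (intro continuous_on_Re) (rule continuous_on_compose2, auto)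
qed

lemma E_real_0: "E_real m x 0 = rGamma m"
  unfolding E_real_def mittag_leffler3_eq by (simp add: powser_zero) (simp add: coeff_def rGamma_complex_of_real)

lemma K_real_pos_iff: "t > 0 \<Longrightarrow> K_real m x t > 0 \<longleftrightarrow> E_real m x t > 0"
  by (simp add: K_real_def zero_less_mult_iff)

text \<open>At a first zero, \<open>of_real_mult_K\<close> would express the kernel as a positive
  multiple of an integral of positive functions. There \<open>K_real 1 1\<close> is evaluated only
  at \<open>t - y < t\<close>, so its positivity before \<open>T\<close> reaches
  \<open>t = T\<close>.\<close>

lemma K_real_pos_if:
  assumes "a > 0" and pos: "\<And>s. 0 < s \<Longrightarrow> s < T \<Longrightarrow> K_real 1 1 s > 0"
    and "0 < t" "t \<le> T"
  shows "K_real (\<nu> * a) a t > 0"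
proof -
  have "E_real (\<nu> * a) a t > 0"
  proof (rule positive_propagation[of T "E_real (\<nu> * a) a"])
    show "continuous_on {0..T} (E_real (\<nu> * a) a)"
      by (rule continuous_on_subset[OF continuous_on_E_real]) auto
    show "E_real (\<nu> * a) a 0 > 0"
      using assms nu_pos Gamma_real_pos[of "\<nu> * a"] by (simp add: E_real_0 rGamma_inverse_Gamma)
    fix t assume t: "0 < t" "t \<le> T" and IH: "\<And>s. 0 \<le> s \<Longrightarrow> s < t \<Longrightarrow> E_real (\<nu> * a) a s > 0"
    note c = K_real_convolution[of 1 "\<nu> * a" t 1 a]
    have "(LBINT y:{0<..<t}. K_real 1 1 (t - y) * K_real (\<nu> * a) a y) > 0"
      using t IH assms nu_pos
      by (intro set_lebesgue_integral_pos_Ioo c mult_pos_pos pos) (auto simp: K_real_pos_iff)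
    then have "K_real (\<nu> * a + 1) (a + 1) t > 0"
      using c(2) t assms nu_pos by (simp add: add.commute)
    moreover have "t * K_real (\<nu> * a) a t = a * \<nu> * K_real (\<nu> * a + 1) (a + 1) t"
    proof -
      have "complex_of_real (t * K_real (\<nu> * a) a t) = of_real (a * \<nu> * K_real (\<nu> * a + 1) (a + 1) t)"
        using of_real_mult_K[OF t(1), of "of_real a"] K_of_real[OF t(1), of "\<nu> * a" a]
          K_of_real[OF t(1), of "\<nu> * a + 1" "a + 1"] by simp
      then show ?thesis by (simp only: of_real_eq_iff)
    qed
    ultimately have "t * K_real (\<nu> * a) a t > 0" using assms nu_pos by simp
    then show "E_real (\<nu> * a) a t > 0" using t by (simp add: K_real_pos_iff zero_less_mult_iff)
  qed (use assms in auto)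
  with assms show ?thesis by (simp add: K_real_pos_iff)
qed

text \<open>For \<open>\<nu> = 1\<close> this is an exponential. For \<open>\<nu> < 1\<close> the
  order \<open>1 - \<nu>\<close> is positive, and \<open>K 1 1\<close> is the convolution of
  \<open>K (1 - \<nu>) 0\<close> with \<open>K \<nu> 1\<close>, which is positive before a first
  zero of \<open>K 1 1\<close>.\<close>

lemma K_real_1_1_pos:
  assumes "\<nu> \<le> 1" "t > 0"
  shows "K_real 1 1 t > 0"
proof (cases "\<nu> = 1")
  case True
  have *: "mittag_leffler3 (of_real \<nu>) (of_real 1) (of_real 1) z = exp z" for z
  proof -
    have "coeff 1 1 r = inverse (fact r)" for r
      unfolding coeff_def unfolding True by (simp add: pochhammer_fact[symmetric] rGamma_inverse_Gamma Gamma_fact add.commute)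
    then show ?thesis
      by (simp add: mittag_leffler3_eq exp_def scaleR_conv_of_real)
  qed
  have "E_real 1 1 t = exp (- lam * t powr \<nu>)"
    unfolding E_real_def * exp_of_real by simp
  then show ?thesis using assms by (simp add: K_real_pos_iff)
next
  case False
  have "E_real 1 1 t > 0"
  proof (rule positive_propagation[of t "E_real 1 1"])
    show "continuous_on {0..t} (E_real 1 1)"
      by (rule continuous_on_subset[OF continuous_on_E_real]) auto
    show "E_real 1 1 0 > 0" by (simp add: E_real_0)
    fix t assume t: "0 < t" and IH: "\<And>s. 0 \<le> s \<Longrightarrow> s < t \<Longrightarrow> E_real 1 1 s > 0"
    \<comment> \<open>\<open>K_real_pos_if\<close> with \<open>a = 1\<close> and
      \<open>T = t\<close> uses \<open>K 1 1\<close> only before \<open>t\<close>, so the two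
      positivity arguments do not run in a circle.\<close>
    have f: "K_real \<nu> 1 s > 0" if "0 < s" "s < t" for s
      using K_real_pos_if[of 1 t s] IH that by (simp add: K_real_pos_iff)
    have k: "K_real (1 - \<nu>) 0 s > 0" if "s > 0" for s
    proof -
      have "of_real (K_real (1 - \<nu>) 0 s) = complex_of_real (s powr (- \<nu>) * rGamma (1 - \<nu>))"
        using K_of_real[OF that, of "1 - \<nu>" 0] K_xi_0[of "of_real (1 - \<nu>)" s] that
        by (simp add: powr_of_real[symmetric] rGamma_complex_of_real[symmetric])
      then have "K_real (1 - \<nu>) 0 s = s powr (- \<nu>) * rGamma (1 - \<nu>)" by (simp only: of_real_eq_iff)
      then show ?thesis using that assms False Gamma_real_pos[of "1 - \<nu>"] by (simp add: rGamma_inverse_Gamma)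
    qed
    note c = K_real_convolution[of "1 - \<nu>" \<nu> t 0 1]
    have "(LBINT y:{0<..<t}. K_real (1 - \<nu>) 0 (t - y) * K_real \<nu> 1 y) > 0"
      using t f k assms nu_pos False
      by (intro set_lebesgue_integral_pos_Ioo c mult_pos_pos) auto
    then show "E_real 1 1 t > 0"
      using c(2) t assms nu_pos False by (simp add: K_real_pos_iff)
  qed (use assms in auto)
  with assms show ?thesis by (simp add: K_real_pos_iff)
qed

lemma K_real_pos:
  assumes "\<nu> \<le> 1" "a > 0" "t > 0"
  shows "K_real (\<nu> * a) a t > 0"
  using K_real_pos_if[of a t t] K_real_1_1_pos assms by auto


section \<open>The waiting time density and its distribution function\<close>

lemma ml_density_eq:
  "ml_density lam \<nu> a t = (if t > 0 then lam powr a * K_real (\<nu> * a) a t else 0)"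
  by (simp add: ml_density_def K_real_def E_real_def mult.commute[of a \<nu>] mult.assoc)

lemma ml_density_pos:
  assumes "\<nu> \<le> 1" "a > 0" "t > 0"
  shows "ml_density lam \<nu> a t > 0"
  using K_real_pos[OF assms] lam_pos assms by (simp add: ml_density_eq)

lemma ml_density_nonneg:
  assumes "\<nu> \<le> 1" "a > 0"
  shows "ml_density lam \<nu> a t \<ge> 0"
  using ml_density_pos[OF assms, of t] by (cases "t > 0") (auto simp: ml_density_def)

text \<open>Both densities vanish off the positive half-line, so the convolution lives on
  \<open>(0, t)\<close> and is the semigroup law. Positivity of the kernels turns it into a
  statement on nonnegative integrals.\<close>

lemma ml_density_convolution:
  assumes nu: "\<nu> \<le> 1" and ab: "a > 0" "b > 0"
  shows "(\<integral>\<^sup>+y. ennreal (ml_density lam \<nu> a (t - y)) * ennreal (ml_density lam \<nu> b y) \<partial>lborel)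
    = ennreal (ml_density lam \<nu> (a + b) t)"
proof (cases "t > 0")
  case True
  let ?f = "\<lambda>y. lam powr (a + b) * (K_real (\<nu> * a) a (t - y) * K_real (\<nu> * b) b y)"
  note c = K_real_convolution[of "\<nu> * a" "\<nu> * b" t a b]
  have nn: "0 \<le> ?f y" if "0 < y" "y < t" for y
    using K_real_pos[OF nu ab(1), of "t - y"] K_real_pos[OF nu ab(2), of y] that by simp
  have "(\<integral>\<^sup>+y. ennreal (ml_density lam \<nu> a (t - y)) * ennreal (ml_density lam \<nu> b y) \<partial>lborel)
    = (\<integral>\<^sup>+y. ennreal (indicator {0<..<t} y * ?f y) \<partial>lborel)"
    using ml_density_nonneg[OF nu ab(1)] ml_density_nonneg[OF nu ab(2)]
    by (intro nn_integral_cong)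
       (simp add: ennreal_mult[symmetric], auto simp: ml_density_eq indicator_def powr_add mult_ac)
  also have "\<dots> = ennreal (LBINT y:{0<..<t}. ?f y)"
    using c(1) True ab nu_pos nn by (intro nn_integral_Ioo_eq set_integrable_mult_right) auto
  also have "(LBINT y:{0<..<t}. ?f y) = ml_density lam \<nu> (a + b) t"
    using c(2) True ab nu_pos by (simp add: ml_density_eq distrib_left)
  finally show ?thesis .
next
  case False
  then have "ennreal (ml_density lam \<nu> a (t - y)) * ennreal (ml_density lam \<nu> b y) = 0" for y
    by (cases "y > 0") (auto simp: ml_density_def)
  then show ?thesis using False by (simp only:) (simp add: ml_density_def)
qed

lemma K_real_1_0: "t > 0 \<Longrightarrow> K_real 1 0 t = 1"
  using K_of_real[of t 1 0] K_xi_0[of 1 t] by (simp add: of_real_eq_1_iff flip: of_real_eq_iff)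

text \<open>Raising the first parameter by 1 is integration from 0. The value \<open>a = 0\<close>
  gives the constant 1 for \<open>t > 0\<close>, which fits arrival time number 0.\<close>

definition ml_cdf :: "real \<Rightarrow> real \<Rightarrow> real" where
  "ml_cdf a t = lam powr a * K_real (\<nu> * a + 1) a t"

lemma ml_cdf_0: "t > 0 \<Longrightarrow> ml_cdf 0 t = 1"
  using lam_pos by (simp add: ml_cdf_def K_real_1_0)

lemma nn_integral_ml_density:
  assumes nu: "\<nu> \<le> 1" and "a > 0" "t > 0"
  shows "(\<integral>\<^sup>+y. ennreal (ml_density lam \<nu> a y) * indicator {..t} y \<partial>lborel) = ennreal (ml_cdf a t)"
proof -
  let ?f = "\<lambda>y. lam powr a * (K_real 1 0 (t - y) * K_real (\<nu> * a) a y)"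
  note c = K_real_convolution[of 1 "\<nu> * a" t 0 a]
  have nn: "0 \<le> ?f y" if "0 < y" "y < t" for y
    using K_real_pos[OF nu assms(2), of y] that by (simp add: K_real_1_0)
  have "(\<integral>\<^sup>+y. ennreal (ml_density lam \<nu> a y) * indicator {..t} y \<partial>lborel) =
      (\<integral>\<^sup>+y. ennreal (indicator {0<..<t} y * ?f y) \<partial>lborel)"
  proof (rule nn_integral_cong_AE)
    show "AE y in lborel. ennreal (ml_density lam \<nu> a y) * indicator {..t} y = ennreal (indicator {0<..<t} y * ?f y)"
      \<comment> \<open>The two integrands can differ at the endpoint \<open>t\<close>, a null
        set.\<close>
      using AE_lborel_singleton[of t]
      by eventually_elim (auto simp: indicator_def ml_density_eq K_real_1_0)
  qed
  also have "\<dots> = ennreal (LBINT y:{0<..<t}. ?f y)"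
    using c(1) assms nu_pos nn by (intro nn_integral_Ioo_eq set_integrable_mult_right) auto
  also have "(LBINT y:{0<..<t}. ?f y) = ml_cdf a t"
    using c(2) assms nu_pos by (simp add: ml_cdf_def add.commute)
  finally show ?thesis .
qed


section \<open>Fractional operators on differences of two kernels\<close>

text \<open>Serves both the Prabhakar operator and the Riemann-Liouville integral; a state
  probability is a difference of two kernels at positive times.\<close>

lemma K_convolution_combination:
  assumes "Re \<mu> > 0" "Re a > 0" "Re b > 0" "t > 0"
    and g: "\<And>y. 0 < y \<Longrightarrow> y < t \<Longrightarrow> g y = A * K a \<xi>1 y - B * K b \<xi>2 y"
  shows "set_integrable lborel {0<..<t} (\<lambda>y. K \<mu> \<xi> (t - y) * g y)"
    and "(LBINT y:{0<..<t}. K \<mu> \<xi> (t - y) * g y) = A * K (\<mu> + a) (\<xi> + \<xi>1) t - B * K (\<mu> + b) (\<xi> + \<xi>2) t"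
proof -
  let ?f = "\<lambda>y. A * (K \<mu> \<xi> (t - y) * K a \<xi>1 y)" and ?h = "\<lambda>y. B * (K \<mu> \<xi> (t - y) * K b \<xi>2 y)"
  have eq: "K \<mu> \<xi> (t - y) * g y = ?f y - ?h y" if "y \<in> {0<..<t}" for y
    using that by (simp add: g algebra_simps)
  have i: "set_integrable lborel {0<..<t} ?f" "set_integrable lborel {0<..<t} ?h"
    by (intro set_integrable_mult_right K_convolution assms impI)+
  have "set_integrable lborel {0<..<t} (\<lambda>y. ?f y - ?h y)"
    using i by (rule set_integral_diff)
  also have "?this \<longleftrightarrow> set_integrable lborel {0<..<t} (\<lambda>y. K \<mu> \<xi> (t - y) * g y)"
    by (rule set_integrable_cong[OF refl refl]) (simp only: eq)
  finally show "set_integrable lborel {0<..<t} (\<lambda>y. K \<mu> \<xi> (t - y) * g y)" .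
  have "(LBINT y:{0<..<t}. K \<mu> \<xi> (t - y) * g y) = (LBINT y:{0<..<t}. ?f y - ?h y)"
    by (rule set_lebesgue_integral_cong) (auto simp: eq)
  also have "\<dots> = (LBINT y:{0<..<t}. ?f y) - (LBINT y:{0<..<t}. ?h y)"
    using i by (rule set_integral_diff)
  finally show "(LBINT y:{0<..<t}. K \<mu> \<xi> (t - y) * g y) = A * K (\<mu> + a) (\<xi> + \<xi>1) t - B * K (\<mu> + b) (\<xi> + \<xi>2) t"
    using assms by (simp add: K_convolution)
qed

lemma prabhakar_integrand_eq:
  "prabhakar_integrand (of_real \<nu>) \<mu> (- of_real lam) \<xi> \<phi> t = (\<lambda>y. K \<mu> \<xi> (t - y) * \<phi> y)"
  by (simp add: prabhakar_integrand_def K_def fun_eq_iff)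

lemma prabhakar_eq:
  "prabhakar (of_real \<nu>) \<mu> (- of_real lam) 0 \<xi> \<phi> t = (LBINT y:{0<..<t}. K \<mu> \<xi> (t - y) * \<phi> y)"
  by (simp only: prabhakar_def prabhakar_integrand_eq)

lemma rl_integral_eq:
  "rl_integral \<beta> g t = (LBINT y:{0<..<t}. K \<beta> 0 (t - y) * g y)"
proof -
  have "(\<lambda>y. K \<beta> 0 (t - y) * g y) = (\<lambda>y. rGamma \<beta> * (of_real (t - y) powr (\<beta> - 1) * g y))"
    by (simp add: K_xi_0 fun_eq_iff mult_ac)
  then show ?thesis
    by (simp add: rl_integral_def rGamma_inverse_Gamma inverse_eq_divide)
qed

lemma rl_integrable_iff:
  assumes "Re \<beta> > 0"
  shows "set_integrable lborel {0<..<t} (\<lambda>y. of_real (t - y) powr (\<beta> - 1) * g y) \<longleftrightarrow>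
    set_integrable lborel {0<..<t} (\<lambda>y. K \<beta> 0 (t - y) * g y)"
proof -
  have "(\<lambda>y. K \<beta> 0 (t - y) * g y) = (\<lambda>y. rGamma \<beta> * (of_real (t - y) powr (\<beta> - 1) * g y))"
    by (simp add: K_xi_0 fun_eq_iff mult_ac)
  moreover have "rGamma \<beta> \<noteq> 0"
    using assms by (simp add: rGamma_eq_zero_iff not_nonpos_Ints_Re)
  ultimately show ?thesis by simp
qed

lemma combination_has_vector_derivative:
  assumes "t > 0" and G: "\<And>s. s > 0 \<Longrightarrow> G s = A * K (\<mu>1 + 1) \<xi>1 s - B * K (\<mu>2 + 1) \<xi>2 s"
  shows "(G has_vector_derivative (A * K \<mu>1 \<xi>1 t - B * K \<mu>2 \<xi>2 t)) (at t)"
proof (rule has_vector_derivative_transform_within_open)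
  show "((\<lambda>s. A * K (\<mu>1 + 1) \<xi>1 s - B * K (\<mu>2 + 1) \<xi>2 s) has_vector_derivative (A * K \<mu>1 \<xi>1 t - B * K \<mu>2 \<xi>2 t)) (at t)"
    by (intro derivative_intros K_has_vector_derivative assms)
  show "t \<in> {0<..}" "open {0::real<..}" using assms by auto
qed (use G in auto)

text \<open>Each derivative lowers both first parameters by one. The induction covers all positive
  times at once, since differentiating needs the formula near \<open>t\<close>.\<close>

lemma iter_deriv_combination:
  assumes G: "\<And>s. s > 0 \<Longrightarrow> G s = A * K (\<mu>1 + of_nat n) \<xi>1 s - B * K (\<mu>2 + of_nat n) \<xi>2 s"
    and "j \<le> n" "t > 0"
  shows "iter_deriv j G t = A * K (\<mu>1 + of_nat (n - j)) \<xi>1 t - B * K (\<mu>2 + of_nat (n - j)) \<xi>2 t"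
  using assms(2,3)
proof (induction j arbitrary: t)
  case 0
  then show ?case using G by (simp add: iter_deriv_def)
next
  case (Suc j)
  then have n: "n - j = Suc (n - Suc j)" by simp
  have "(iter_deriv j G has_vector_derivative
      (A * K (\<mu>1 + of_nat (n - Suc j)) \<xi>1 t - B * K (\<mu>2 + of_nat (n - Suc j)) \<xi>2 t)) (at t)"
    using Suc by (intro combination_has_vector_derivative) (auto simp: n add_ac)
  then show ?case
    by (simp add: iter_deriv_def vector_derivative_at)
qed

lemma iter_deriv_combination_differentiable:
  assumes G: "\<And>s. s > 0 \<Longrightarrow> G s = A * K (\<mu>1 + of_nat n) \<xi>1 s - B * K (\<mu>2 + of_nat n) \<xi>2 s"
    and "j < n" "t > 0"
  shows "iter_deriv j G differentiable (at t)"
proof -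
  have n: "n - j = Suc (n - Suc j)" using assms by simp
  have "(iter_deriv j G has_vector_derivative
      (A * K (\<mu>1 + of_nat (n - Suc j)) \<xi>1 t - B * K (\<mu>2 + of_nat (n - Suc j)) \<xi>2 t)) (at t)"
    using assms iter_deriv_combination[OF G, of j]
    by (intro combination_has_vector_derivative) (auto simp: n add_ac)
  then show ?thesis by (rule differentiableI_vector)
qed

text \<open>The fractional integral raises the first parameters by \<open>n - \<alpha>\<close> and
  the \<open>n\<close> derivatives lower them by \<open>n\<close>. The outcome may leave the
  half-plane of integrable kernels, but it is only evaluated at \<open>t > 0\<close>.\<close>

lemma rl_derivative_combination:
  assumes alpha: "Re \<alpha> > 0" and ab: "Re a > 0" "Re b > 0"
    and g: "\<And>y. y > 0 \<Longrightarrow> g y = A * K a \<xi>1 y - B * K b \<xi>2 y"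
  shows "rl_differentiable \<alpha> g"
    and "t > 0 \<Longrightarrow> rl_derivative \<alpha> g t = A * K (a - \<alpha>) \<xi>1 t - B * K (b - \<alpha>) \<xi>2 t"
proof -
  define n where "n = rl_order \<alpha>"
  define \<beta> where "\<beta> = of_nat n - \<alpha>"
  \<comment> \<open>\<open>rl_order\<close> is one more than the floor, so it exceeds
    \<open>Re \<alpha>\<close> strictly even when that is an integer.\<close>
  have beta: "Re \<beta> > 0"
    using alpha unfolding \<beta>_def n_def rl_order_def by (simp add: of_nat_nat) linarith
  have G: "rl_integral \<beta> g s = A * K ((a - \<alpha>) + of_nat n) \<xi>1 s - B * K ((b - \<alpha>) + of_nat n) \<xi>2 s" if "s > 0" for s
    using K_convolution_combination(2)[OF beta ab that, of g A \<xi>1 B \<xi>2 0] g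
    by (simp add: rl_integral_eq \<beta>_def algebra_simps)
  show "rl_differentiable \<alpha> g"
    unfolding rl_differentiable_def n_def[symmetric] \<beta>_def[symmetric] rl_integrable_iff[OF beta]
    using K_convolution_combination(1)[OF beta ab, of _ g A \<xi>1 B \<xi>2 0] g
      iter_deriv_combination_differentiable[of "rl_integral \<beta> g", OF G]
    by simp
  show "rl_derivative \<alpha> g t = A * K (a - \<alpha>) \<xi>1 t - B * K (b - \<alpha>) \<xi>2 t" if "t > 0"
    unfolding rl_derivative_def n_def[symmetric] \<beta>_def[symmetric]
    using iter_deriv_combination[of "rl_integral \<beta> g", OF G order_refl that] by simp
qed

end

section \<open>The renewal process\<close>

locale ml_renewal = prabhakar_kernel lam \<nu> + prob_space M
  for lam \<nu> :: real and M :: "'a measure" +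
  fixes \<delta> :: real and X :: "nat \<Rightarrow> 'a \<Rightarrow> real"
  assumes nu_le_1: "\<nu> \<le> 1" and delta_pos: "\<delta> > 0"
    and indep: "indep_vars (\<lambda>_. borel) X UNIV"
    and distributed_X: "\<And>i. distributed M lborel (X i) (\<lambda>t. ennreal (ml_density lam \<nu> \<delta> t))"
begin

section \<open>Distribution of the arrival times\<close>

lemma measurable_X [measurable]: "X i \<in> borel_measurable M"
  using distributed_measurable[OF distributed_X[of i]] by simp

lemma measurable_arrival_time [measurable]: "arrival_time X m \<in> borel_measurable M"
  unfolding arrival_time_def[abs_def] by measurable

text \<open>Induction with the convolution law, starting at index 1 because arrival time 0 is
  constant and has no density.\<close>

lemma distributed_arrival_time:
  "distributed M lborel (arrival_time X (Suc m)) (\<lambda>t. ennreal (ml_density lam \<nu> (real (Suc m) * \<delta>) t))"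
proof (induction m)
  case 0
  then show ?case using distributed_X[of 0] by (simp add: arrival_time_def[abs_def])
next
  case (Suc m)
  have "indep_var borel (X (Suc m)) borel (\<lambda>\<omega>. \<Sum>i<Suc m. X i \<omega>)"
    by (rule indep_vars_sum) (auto intro: indep_vars_subset[OF indep])
  from distributed_convolution[OF this distributed_X Suc[unfolded arrival_time_def[abs_def]]]
  have "distributed M lborel (\<lambda>\<omega>. X (Suc m) \<omega> + (\<Sum>i<Suc m. X i \<omega>))
     (\<lambda>t. \<integral>\<^sup>+y. ennreal (ml_density lam \<nu> \<delta> (t - y)) * ennreal (ml_density lam \<nu> (real (Suc m) * \<delta>) y) \<partial>lborel)" .
  also have "(\<lambda>\<omega>. X (Suc m) \<omega> + (\<Sum>i<Suc m. X i \<omega>)) = arrival_time X (Suc (Suc m))"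
    by (simp add: arrival_time_def fun_eq_iff)
  also have "(\<lambda>t. \<integral>\<^sup>+y. ennreal (ml_density lam \<nu> \<delta> (t - y)) * ennreal (ml_density lam \<nu> (real (Suc m) * \<delta>) y) \<partial>lborel)
     = (\<lambda>t. ennreal (ml_density lam \<nu> (real (Suc (Suc m)) * \<delta>) t))"
    using delta_pos by (subst ml_density_convolution[OF nu_le_1]) (auto simp: algebra_simps intro!: add_pos_nonneg)
  finally show ?case .
qed

lemma prob_arrival_time_le:
  assumes "t > 0"
  shows "prob {\<omega> \<in> space M. arrival_time X m \<omega> \<le> t} = ml_cdf (real m * \<delta>) t"
proof (cases m)
  case 0
  then show ?thesis using assms by (simp add: arrival_time_def ml_cdf_0 prob_space)
next
  case (Suc k)
  have "{\<omega> \<in> space M. arrival_time X m \<omega> \<le> t} = arrival_time X m -` {..t} \<inter> space M" by auto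
  then have "emeasure M {\<omega> \<in> space M. arrival_time X m \<omega> \<le> t} = ennreal (ml_cdf (real m * \<delta>) t)"
    using distributed_emeasure[OF distributed_arrival_time[of k], of "{..t}"] Suc
      nn_integral_ml_density[OF nu_le_1 _ assms, of "real m * \<delta>"] delta_pos by simp
  \<comment> \<open>\<open>ennreal\<close> sends negative reals to 0, so nonnegativity is needed to
    read off the real value.\<close>
  moreover have "ml_cdf (real m * \<delta>) t \<ge> 0"
  proof -
    have "K_real (\<nu> * (real m * \<delta>) + 1) (real m * \<delta>) t = (LBINT y:{0<..<t}. K_real 1 0 (t - y) * K_real (\<nu> * (real m * \<delta>)) (real m * \<delta>) y)"
      using K_real_convolution(2)[of 1 "\<nu> * (real m * \<delta>)" t 0 "real m * \<delta>"] assms delta_pos nu_pos Suc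
      by (simp add: add.commute)
    also have "\<dots> \<ge> 0"
      unfolding set_lebesgue_integral_def using K_real_pos[OF nu_le_1, of "real m * \<delta>"] delta_pos Suc
      by (intro Bochner_Integration.integral_nonneg) (auto simp: indicator_def K_real_1_0 intro: less_imp_le)
    finally show ?thesis by (simp add: ml_cdf_def)
  qed
  ultimately show ?thesis by (simp add: measure_def)
qed

section \<open>Almost sure behaviour of the paths\<close>

lemma AE_X_pos: "AE \<omega> in M. \<forall>i. X i \<omega> > 0"
proof (subst AE_all_countable, rule allI)
  fix i
  have "emeasure M (X i -` {..0} \<inter> space M) = 0"
  proof -
    have "(\<lambda>x. ennreal (ml_density lam \<nu> \<delta> x) * indicator {..0} x) = (\<lambda>_. 0)"
      by (auto simp: fun_eq_iff ml_density_def indicator_def)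
    then show ?thesis by (subst distributed_emeasure[OF distributed_X]) auto
  qed
  moreover have "X i -` {..0} \<inter> space M = {\<omega> \<in> space M. \<not> X i \<omega> > 0}" by auto
  ultimately show "AE \<omega> in M. X i \<omega> > 0"
    by (subst AE_iff_measurable[OF _ refl]) auto
qed

text \<open>Exponential Markov bound: the probability of staying below \<open>t\<close> is at most
  \<open>exp t * q ^ m\<close> for every \<open>m\<close>, by independence. Hence the set counted at
  time \<open>t\<close> is almost surely bounded.\<close>

lemma AE_arrival_time_exceeds: "AE \<omega> in M. \<exists>m. arrival_time X m \<omega> > t"
proof -
  define q where "q = expectation (\<lambda>\<omega>. exp (- X 0 \<omega>))"
  have AEX: "AE \<omega> in M. X i \<omega> > 0" for i using AE_X_pos by eventually_elim simp
  have int: "integrable M (\<lambda>\<omega>. exp (- X i \<omega>))" for i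
    by (rule integrable_const_bound[where B = 1]) (use AEX[of i] in \<open>auto elim!: eventually_mono\<close>)
  have q: "expectation (\<lambda>\<omega>. exp (- X i \<omega>)) = q" for i
    using distributed_integral[OF distributed_X[of i], of "\<lambda>x. exp (- x)"]
      distributed_integral[OF distributed_X[of 0], of "\<lambda>x. exp (- x)"] ml_density_nonneg[OF nu_le_1 delta_pos]
    by (simp add: q_def)
  have "q \<ge> 0" unfolding q_def by (intro integral_nonneg_AE) auto
  \<comment> \<open>Strict, because \<open>exp (- X 0 \<omega>) < 1\<close> almost surely.\<close>
  have "q < expectation (\<lambda>_. 1)"
    unfolding q_def
    by (rule integral_less_AE_space) (use AEX[of 0] int in \<open>auto simp: emeasure_space_1 elim!: eventually_mono\<close>)
  then have "q < 1" by (simp add: prob_space)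
  have ind: "indep_vars (\<lambda>_. borel) (\<lambda>i \<omega>. exp (- X i \<omega>)) {..<m}" for m
    by (rule indep_vars_compose2[where Y = "\<lambda>_ x. exp (- x)", OF indep_vars_subset[OF indep]]) auto
  have exp_eq: "exp (- arrival_time X m \<omega>) = (\<Prod>i<m. exp (- X i \<omega>))" for m \<omega>
    by (simp add: arrival_time_def sum_negf exp_sum[symmetric])
  have intm: "integrable M (\<lambda>\<omega>. exp (- arrival_time X m \<omega>))" for m
    unfolding exp_eq by (rule indep_vars_integrable) (use ind int in auto)
  have em: "expectation (\<lambda>\<omega>. exp (- arrival_time X m \<omega>)) = q ^ m" for m
    unfolding exp_eq by (subst indep_vars_lebesgue_integral) (use ind int q in auto)
  let ?B = "{\<omega> \<in> space M. \<forall>m. arrival_time X m \<omega> \<le> t}"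
  have "prob ?B \<le> exp t * q ^ m" for m
  proof -
    have "prob ?B = expectation (indicator ?B)" by simp
    also have "\<dots> \<le> expectation (\<lambda>\<omega>. exp t * exp (- arrival_time X m \<omega>))"
    proof (rule integral_mono)
      show "integrable M (indicat_real ?B)" by (simp add: integrable_indicator_iff less_top[symmetric])
      show "integrable M (\<lambda>\<omega>. exp t * exp (- arrival_time X m \<omega>))" using intm by simp
      show "indicator ?B \<omega> \<le> exp t * exp (- arrival_time X m \<omega>)" for \<omega>
        by (auto simp: indicator_def simp flip: exp_add)
    qed
    also have "\<dots> = exp t * q ^ m" by (simp add: em)
    finally show ?thesis .
  qed
  moreover have "(\<lambda>m. exp t * q ^ m) \<longlonglongrightarrow> 0"
    using \<open>q \<ge> 0\<close> \<open>q < 1\<close> by (intro tendsto_mult_right_zero LIMSEQ_realpow_zero)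
  ultimately have "prob ?B \<le> 0" using LIMSEQ_le_const by blast
  then have "prob ?B = 0" by (simp add: measure_le_0_iff)
  then have "emeasure M ?B = 0" by (simp add: emeasure_eq_measure)
  then show ?thesis
    by (subst AE_iff_measurable[OF _ refl]) (auto simp: not_less)
qed

section \<open>State probabilities\<close>

text \<open>Positive waiting times make the arrival times monotone, and one arrival after
  \<open>t\<close> makes the set under \<open>Max\<close> finite; 0 belongs to it.\<close>

lemma renewal_count_eq_iff:
  assumes "t \<ge> 0" and pos: "\<And>i. X i \<omega> > 0" and "arrival_time X b \<omega> > t"
  shows "renewal_count X t \<omega> = k \<longleftrightarrow> arrival_time X k \<omega> \<le> t \<and> arrival_time X (Suc k) \<omega> > t"
proof -
  let ?A = "{m. arrival_time X m \<omega> \<le> t}"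
  have mono: "arrival_time X m \<omega> \<le> arrival_time X n \<omega>" if "m \<le> n" for m n
    unfolding arrival_time_def using that pos by (intro sum_mono2) (auto intro: less_imp_le)
  have "?A \<subseteq> {..<b}"
  proof
    fix m assume "m \<in> ?A"
    with mono[of b m] assms(3) show "m \<in> {..<b}" by (cases "b \<le> m") auto
  qed
  then have fin: "finite ?A" by (rule finite_subset) auto
  have "0 \<in> ?A" using assms(1) by (simp add: arrival_time_def)
  then have ne: "?A \<noteq> {}" by blast
  have "renewal_count X t \<omega> = k \<longleftrightarrow> k \<in> ?A \<and> (\<forall>m\<in>?A. m \<le> k)"
    unfolding renewal_count_def by (rule Max_eq_iff[OF fin ne])
  also have "(\<forall>m\<in>?A. m \<le> k) \<longleftrightarrow> arrival_time X (Suc k) \<omega> > t"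
  proof
    assume "\<forall>m\<in>?A. m \<le> k"
    then have "Suc k \<notin> ?A" by (metis Suc_n_not_le_n)
    then show "arrival_time X (Suc k) \<omega> > t" by simp
  next
    assume *: "arrival_time X (Suc k) \<omega> > t"
    show "\<forall>m\<in>?A. m \<le> k"
    proof
      fix m assume "m \<in> ?A"
      with * mono[of "Suc k" m] show "m \<le> k" by (cases "Suc k \<le> m") auto
    qed
  qed
  finally show ?thesis by simp
qed

text \<open>Countable quantifiers over the arrival times describe the whole event, so that
  \<open>measure_eq_AE\<close> can compare it with a simpler one.\<close>

lemma sets_renewal_count:
  assumes "t \<ge> 0"
  shows "{\<omega> \<in> space M. renewal_count X t \<omega> = k} \<in> sets M"
proof -
  have "renewal_count X t \<omega> = k \<longleftrightarrow>
    (if \<exists>b. \<forall>m. arrival_time X m \<omega> \<le> t \<longrightarrow> m \<le> b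
     then arrival_time X k \<omega> \<le> t \<and> (\<forall>m. arrival_time X m \<omega> \<le> t \<longrightarrow> m \<le> k)
     else Max (UNIV :: nat set) = k)" for \<omega>
      \<comment> \<open>\<open>Max\<close> takes the same unspecified value on all infinite sets.\<close>
  proof (cases "finite {m. arrival_time X m \<omega> \<le> t}")
    case True
    moreover have "0 \<in> {m. arrival_time X m \<omega> \<le> t}" using assms by (simp add: arrival_time_def)
    ultimately show ?thesis
      unfolding renewal_count_def using Max_eq_iff[OF True, of k]
      by (auto simp: finite_nat_set_iff_bounded_le)
  next
    case False
    then have "\<not> (\<exists>b. \<forall>m. arrival_time X m \<omega> \<le> t \<longrightarrow> m \<le> b)"
      by (auto simp: finite_nat_set_iff_bounded_le)
    moreover have "renewal_count X t \<omega> = Max UNIV"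
      unfolding renewal_count_def using False by (simp only: Max.infinite infinite_UNIV_nat not_False_eq_True)
    ultimately show ?thesis by (simp only: if_False)
  qed
  then show ?thesis by (simp only:) measurable
qed

text \<open>Up to a null set, the event is that arrival \<open>k\<close> has happened by time
  \<open>t\<close> and arrival \<open>Suc k\<close> has not.\<close>

lemma state_prob_eq:
  assumes "t > 0"
  shows "state_prob M X k t = ml_cdf (real k * \<delta>) t - ml_cdf (real (Suc k) * \<delta>) t"
proof -
  let ?N = "{\<omega> \<in> space M. renewal_count X t \<omega> = k}"
  let ?T = "\<lambda>m. {\<omega> \<in> space M. arrival_time X m \<omega> \<le> t}"
  have [measurable]: "?N \<in> sets M" using assms by (intro sets_renewal_count) simp
  have "AE \<omega> in M. renewal_count X t \<omega> = k \<longleftrightarrow> arrival_time X k \<omega> \<le> t \<and> arrival_time X (Suc k) \<omega> > t"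
    using AE_X_pos AE_arrival_time_exceeds[of t]
    by eventually_elim (use renewal_count_eq_iff[of t] assms in auto)
  then have "AE \<omega> in M. \<omega> \<in> ?N \<longleftrightarrow> \<omega> \<in> ?T k - ?T (Suc k)"
    by eventually_elim auto
  then have "prob ?N = prob (?T k - ?T (Suc k))"
    by (intro measure_eq_AE) auto
  also have "\<dots> = prob (?T k) - prob (?T k \<inter> ?T (Suc k))"
    by (rule finite_measure_Diff') measurable
  also have "prob (?T k \<inter> ?T (Suc k)) = prob (?T (Suc k))"
  proof (rule measure_eq_AE)
    show "AE \<omega> in M. \<omega> \<in> ?T k \<inter> ?T (Suc k) \<longleftrightarrow> \<omega> \<in> ?T (Suc k)"
      using AE_X_pos
    proof eventually_elim
      case (elim \<omega>)
      then have "0 < X k \<omega>" by blast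
      then show ?case by (auto simp: arrival_time_def)
    qed
  qed measurable
  finally show ?thesis
    unfolding state_prob_def prob_arrival_time_le[OF assms] .
qed

lemma state_prob_K:
  assumes "t > 0"
  shows "complex_of_real (state_prob M X k t) =
    of_real (lam powr (real k * \<delta>)) * K (of_real (\<nu> * (real k * \<delta>) + 1)) (of_real (real k * \<delta>)) t -
    of_real (lam powr (real (Suc k) * \<delta>)) * K (of_real (\<nu> * (real (Suc k) * \<delta>) + 1)) (of_real (real (Suc k) * \<delta>)) t"
  unfolding state_prob_eq[OF assms] K_of_real[OF assms] ml_cdf_def by (simp only: of_real_diff of_real_mult)

end

section \<open>The fractional equation\<close>

theorem theorem2p2:
  fixes M :: "'a measure" and X :: "nat \<Rightarrow> 'a \<Rightarrow> real"
    and lam \<nu> \<delta> :: real and \<theta> :: complex and k :: nat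
  assumes "lam > 0" and "0 < \<nu>" and "\<nu> \<le> 1" and "\<delta> > 0" and "Re \<theta> > 0"
    and "prob_space M"
    and "prob_space.indep_vars M (\<lambda>_. borel) X UNIV"
    and "\<And>i. distributed M lborel (X i) (\<lambda>t. ennreal (ml_density lam \<nu> \<delta> t))"
  defines "p \<equiv> \<lambda>j t. complex_of_real (state_prob M X j t)"
  defines "P \<equiv> prabhakar (of_real \<nu>) \<theta> (- of_real lam) 0 (- of_real \<delta>) (p k)"
  shows "(\<forall>t>0. set_integrable lborel {0<..<t}
            (prabhakar_integrand (of_real \<nu>) \<theta> (- of_real lam) (- of_real \<delta>) (p k) t))
     \<and> rl_differentiable (of_real (\<nu> * \<delta>) + \<theta>) P
     \<and> (\<forall>t>0. rl_derivative (of_real (\<nu> * \<delta>) + \<theta>) P t =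
            of_real (lam powr \<delta>) * (if k = 0 then 0 else p (k - 1) t)
            + (if k = 0 then 1 else 0) *
              (of_real (t powr (- \<nu> * \<delta>)) *
                 mittag_leffler3 (of_real \<nu>) (of_real (1 - \<nu> * \<delta>)) (- of_real \<delta>)
                   (of_real (- lam * t powr \<nu>))
               - of_real (lam powr \<delta>)))"
proof -
  interpret ml_renewal lam \<nu> M \<delta> X
    using assms(1-8) by (simp add: ml_renewal_def prabhakar_kernel_def ml_renewal_axioms_def)
  let ?a = "\<lambda>j. complex_of_real (\<nu> * (real j * \<delta>) + 1)" and ?\<xi> = "\<lambda>j. complex_of_real (real j * \<delta>)"
    and ?A = "\<lambda>j. complex_of_real (lam powr (real j * \<delta>))"
  have a: "Re (?a j) > 0" for j
    using assms(2,4) by (simp add: add_nonneg_pos)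
  have p: "p j t = ?A j * K (?a j) (?\<xi> j) t - ?A (Suc j) * K (?a (Suc j)) (?\<xi> (Suc j)) t" if "t > 0" for j t
    unfolding p_def by (rule state_prob_K[OF that])
  \<comment> \<open>The Prabhakar operator adds \<open>\<theta>\<close> and
    \<open>- \<delta>\<close> to the parameters of both kernels.\<close>
  note c = K_convolution_combination[OF assms(5) a a, of _ "p k" "?A k" k "?\<xi> k" "?A (Suc k)" "Suc k" "?\<xi> (Suc k)" "- of_real \<delta>", OF _ p]
  have P: "P t = ?A k * K (\<theta> + ?a k) (- of_real \<delta> + ?\<xi> k) t -
      ?A (Suc k) * K (\<theta> + ?a (Suc k)) (- of_real \<delta> + ?\<xi> (Suc k)) t" if "t > 0" for t
    unfolding P_def prabhakar_eq by (rule c(2)) (use that in auto)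
  have alpha: "Re (of_real (\<nu> * \<delta>) + \<theta>) > 0"
    using assms by (simp add: add_pos_pos)
  have ta: "Re (\<theta> + ?a j) > 0" for j using a[of j] assms(5) by simp
  note d = rl_derivative_combination[OF alpha ta ta P]
  \<comment> \<open>The derivative removes \<open>\<theta>\<close> and lowers the first parameter by
    a further \<open>\<nu> * \<delta>\<close>; together with the shift by \<open>- \<delta>\<close>
    this moves the kernel of index \<open>Suc j\<close> to index \<open>j\<close>.\<close>
  have shift: "\<theta> + ?a (Suc j) - (of_real (\<nu> * \<delta>) + \<theta>) = ?a j" "- of_real \<delta> + ?\<xi> (Suc j) = ?\<xi> j" for j
    by (simp_all add: algebra_simps)
  have deriv: "rl_derivative (of_real (\<nu> * \<delta>) + \<theta>) P t =
      of_real (lam powr \<delta>) * (if k = 0 then 0 else p (k - 1) t)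
      + (if k = 0 then 1 else 0) *
        (of_real (t powr (- \<nu> * \<delta>)) *
           mittag_leffler3 (of_real \<nu>) (of_real (1 - \<nu> * \<delta>)) (- of_real \<delta>)
             (of_real (- lam * t powr \<nu>))
         - of_real (lam powr \<delta>))" if t: "t > 0" for t
  proof (cases k)
    case 0
    \<comment> \<open>For \<open>k = 0\<close> the first kernel has no predecessor and yields the
      explicit Mittag-Leffler term, while the second becomes \<open>K 1 0 = 1\<close> and yields
      \<open>- lam powr \<delta>\<close>.\<close>
    have "K (\<theta> + ?a 0 - (of_real (\<nu> * \<delta>) + \<theta>)) (- of_real \<delta> + ?\<xi> 0) t =
        K (of_real (1 - \<nu> * \<delta>)) (- of_real \<delta>) t"
      by simp
    also have "\<dots> = of_real (t powr (- \<nu> * \<delta>)) *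
           mittag_leffler3 (of_real \<nu>) (of_real (1 - \<nu> * \<delta>)) (- of_real \<delta>) (of_real (- lam * t powr \<nu>))"
      using t powr_of_real[of t "- \<nu> * \<delta>"] powr_of_real[of t \<nu>] by (simp add: K_def)
    finally show ?thesis
      using d(2)[OF _ t, unfolded shift] t assms(1) 0 K_xi_0[of 1 t] by simp
  next
    case (Suc j)
    have A_Suc: "?A (Suc i) = of_real (lam powr \<delta>) * ?A i" for i
      by (simp add: distrib_right powr_add)
    have "rl_derivative (of_real (\<nu> * \<delta>) + \<theta>) P t =
        ?A (Suc j) * K (?a j) (?\<xi> j) t - ?A (Suc (Suc j)) * K (?a (Suc j)) (?\<xi> (Suc j)) t"
      using d(2)[OF _ t] unfolding Suc shift by blast
    also have "\<dots> = of_real (lam powr \<delta>) * p j t"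
      by (simp only: A_Suc p[OF t] right_diff_distrib mult.assoc)
    finally show ?thesis using Suc by simp
  qed
  show ?thesis
    using c(1) d(1) deriv by (simp add: prabhakar_integrand_eq)
qed

end
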